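(* Let $k\ge 2$ be an integer. If $d_1$ and $d_2$ are two chord diagrams whose intersection graphs $\gamma(d_1)$ and $\gamma(d_2)$ coincide (i.e. are isomorphic as simple undirected graphs), then $R_k(d_1)=R_k(d_2)$.
   Context: A chord diagram of order $n$ is an oriented circle (positive direction $=$ counterclockwise) with $2n$ pairwise distinct points split into $n$ disjoint (unordered) pairs, considered up to orientation-preserving diffeomorphisms of the circle; each pair is called a chord and its two points are its ends. Two distinct chords intersect if their ends alternate along the circle. The intersection graph $\gamma(d)$ of a chord diagram $d$ is the simple graph whose vertices are the chords of $d$, two vertices being adjacent iff the corresponding chords intersect. Directed intersection graph. Choose an orientation of each chord of $d$, i.e. declare one end its beginning and the other its end. Each edge of $\gamma(d)$ joining intersecting chords $A,B$ is then oriented from $A$ to $B$ if the beginning of $B$ belongs to the arc of the circle that starts at the beginning of $A$ and goes in the positive direction to the end of $A$ (otherwise it is oriented from $B$ to $A$). Oriented edges are called arrows. Signs. A $2k$-gon (circuit of length $2k$) in a directed graph is a cycle subgraph of length $2k$ with $2k$ pairwise distinct vertices in the underlying simple graph (counted without regard to starting vertex and direction of traversal). It is positively oriented if, for a chosen direction of traversal, the number of its arrows oriented in that direction is even, and negatively oriented otherwise; since the total number of arrows is even, this does not depend on the direction of traversal. Definition of $R_k$. For $k=2,3,4,\dots$, $R_k(d)$ is the number of positively oriented $2k$-gons minus the number of negatively oriented $2k$-gons in the directed intersection graph $\gamma(d)$, for an arbitrarily chosen orientation of the chords of $d$; the value does not depend on this choice. *)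

theory Defs
  imports "HOL-Analysis.Analysis"
begin

text \<open>The oriented circle is the unit circle of the complex plane, oriented counterclockwise. A chord
  is the set of its two ends, and a chord diagram is the set of its chords. We work with concrete
  diagrams instead of classes under orientation-preserving diffeomorphisms of the circle: all the
  notions below depend only on the cyclic order of the ends, which such maps preserve.\<close>

type_synonym chord = "complex set"

definition chord_diagram :: "chord set \<Rightarrow> bool" where
  "chord_diagram d \<longleftrightarrow>
     finite d \<and> (\<forall>A\<in>d. A \<subseteq> sphere 0 1 \<and> card A = 2) \<and> pairwise disjnt d"

text \<open>The closed arc that starts at \<open>a\<close> and goes counterclockwise to \<open>b\<close>.\<close>

definition arc_from_to :: "complex \<Rightarrow> complex \<Rightarrow> complex set" where
  "arc_from_to a b = {a * cis t | t. 0 \<le> t \<and> t \<le> Arg2pi (b / a)}"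

definition chords_intersect :: "chord \<Rightarrow> chord \<Rightarrow> bool" where
  "chords_intersect A B \<longleftrightarrow> A \<inter> B = {} \<and>
     (\<exists>a a' b b'. A = {a, a'} \<and> B = {b, b'} \<and> b \<in> arc_from_to a a' \<and> b' \<in> arc_from_to a' a)"

text \<open>A simple graph is given by its vertices and its edges, the latter being two-element sets of
  vertices.\<close>

type_synonym 'a sgraph = "'a set \<times> 'a set set"

definition sgraph_isomorphic :: "'a sgraph \<Rightarrow> 'b sgraph \<Rightarrow> bool" where
  "sgraph_isomorphic G H \<longleftrightarrow>
     (\<exists>f. bij_betw f (fst G) (fst H) \<and>
       (\<forall>u\<in>fst G. \<forall>v\<in>fst G. {u, v} \<in> snd G \<longleftrightarrow> {f u, f v} \<in> snd H))"

definition intersection_graph :: "chord set \<Rightarrow> chord sgraph" where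
  "intersection_graph d = (d, {{A, B} | A B. A \<in> d \<and> B \<in> d \<and> A \<noteq> B \<and> chords_intersect A B})"

text \<open>An orientation of the chords is given by the function mapping each chord to its beginning.\<close>

definition chord_orientation :: "chord set \<Rightarrow> (chord \<Rightarrow> complex) \<Rightarrow> bool" where
  "chord_orientation d beg \<longleftrightarrow> (\<forall>A\<in>d. beg A \<in> A)"

definition chord_end :: "(chord \<Rightarrow> complex) \<Rightarrow> chord \<Rightarrow> complex" where
  "chord_end beg A = the_elem (A - {beg A})"

text \<open>For intersecting \<open>A\<close> and \<open>B\<close>, exactly one of \<open>arrow d beg A B\<close> and \<open>arrow d beg B A\<close> holds,
  because the ends of \<open>A\<close> and \<open>B\<close> alternate.\<close>

definition arrow :: "chord set \<Rightarrow> (chord \<Rightarrow> complex) \<Rightarrow> chord \<Rightarrow> chord \<Rightarrow> bool" where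
  "arrow d beg A B \<longleftrightarrow>
     {A, B} \<in> snd (intersection_graph d) \<and> beg B \<in> arc_from_to (beg A) (chord_end beg A)"

text \<open>A traversal of a circuit of length \<open>m\<close> lists its vertices in cyclic order; the circuit itself,
  a subgraph, is represented by its set of edges and so does not remember the starting vertex and
  the direction. This is meaningful for \<open>m \<ge> 3\<close>.\<close>

definition circuit_traversal :: "'a sgraph \<Rightarrow> nat \<Rightarrow> 'a list \<Rightarrow> bool" where
  "circuit_traversal G m vs \<longleftrightarrow>
     length vs = m \<and> distinct vs \<and> set vs \<subseteq> fst G \<and>
     (\<forall>i<m. {vs ! i, vs ! (Suc i mod m)} \<in> snd G)"

definition traversed_edges :: "'a list \<Rightarrow> 'a set set" where
  "traversed_edges vs = {{vs ! i, vs ! (Suc i mod length vs)} | i. i < length vs}"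

definition circuits :: "'a sgraph \<Rightarrow> nat \<Rightarrow> 'a set set set" where
  "circuits G m = {traversed_edges vs | vs. circuit_traversal G m vs}"

definition forward_arrows :: "('a \<Rightarrow> 'a \<Rightarrow> bool) \<Rightarrow> 'a list \<Rightarrow> nat" where
  "forward_arrows D vs = card {i. i < length vs \<and> D (vs ! i) (vs ! (Suc i mod length vs))}"

text \<open>For circuits of even length the parity does not depend on the traversal chosen.\<close>

definition positively_oriented ::
    "'a sgraph \<Rightarrow> ('a \<Rightarrow> 'a \<Rightarrow> bool) \<Rightarrow> nat \<Rightarrow> 'a set set \<Rightarrow> bool" where
  "positively_oriented G D m C \<longleftrightarrow>
     (\<exists>vs. circuit_traversal G m vs \<and> traversed_edges vs = C \<and> even (forward_arrows D vs))"

text \<open>The number \<open>R\<^sub>k(d)\<close> computed with the orientation \<open>beg\<close> of the chords of \<open>d\<close>.\<close>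

definition R :: "nat \<Rightarrow> chord set \<Rightarrow> (chord \<Rightarrow> complex) \<Rightarrow> int" where
  "R k d beg =
     (let G = intersection_graph d; pos = positively_oriented G (arrow d beg) (2 * k)
      in int (card {C \<in> circuits G (2 * k). pos C}) - int (card {C \<in> circuits G (2 * k). \<not> pos C}))"

end

theory Submission
  imports Defs
begin

text \<open>Attach to a chord diagram with oriented chords the skew-symmetric integer matrix \<open>M\<close>, indexed by
  the chords, whose entry \<open>M A B\<close> is \<open>1\<close> for an arrow from \<open>A\<close> to \<open>B\<close>, \<open>-1\<close> for an arrow from \<open>B\<close> to
  \<open>A\<close>, and \<open>0\<close> if the two chords do not cross. The sign of a circuit of even length is the product
  of the entries of \<open>M\<close> along any traversal of it. So, up to the number of traversals of a circuit,
  which depends on the length only, \<open>R k\<close> is the sum over all lists of \<open>2 * k\<close> distinct chords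
  of the cyclic products of \<open>M\<close> (\<open>cycle_weight_sum_eq_R\<close>). The matrix \<open>M\<close> itself is not determined by the
  intersection graph, not even up to changing the orientations of the chords: reflecting the circle
  keeps the graph and replaces \<open>M\<close> by its negative, which changes the cyclic products along triangles. But its principal minors are
  determined by the graph, and they in turn determine the sums of the cyclic products.

  The minors determine the cycle sums. In the Leibniz formula, the permutations are sorted by the
  cycle that contains a fixed index \<open>s\<close>. This expresses the minor on \<open>insert s S\<close> through smaller minors
  and sums over cycles that start at \<open>s\<close> and run through prescribed sets of vertices
  (\<open>principal_minor_hamiltonian_expansion\<close>). The sum over the cycles through all of \<open>S\<close> occurs with coefficient
  \<open>1\<close> or \<open>-1\<close>, so these relations can be solved recursively (\<open>hamiltonian_sum_determined_by_minors\<close>).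

  The graph determines the minors. Every principal minor of \<open>M\<close> is \<open>0\<close> or \<open>1\<close>
  (\<open>crossing_matrix_principally_unimodular\<close>). To see this, pick two crossing chords \<open>A\<close> and \<open>B\<close> and
  eliminate their rows and columns. The four ends of \<open>A\<close> and \<open>B\<close> cut the circle into arcs \<open>P\<close>, \<open>Q\<close>, \<open>S\<close>, \<open>T\<close>,
  in this cyclic order, and the Schur complement turns out to be the signed crossing matrix of the diagram in
  which \<open>A\<close> and \<open>B\<close> are removed and the arcs are glued together in the order \<open>S\<close>, \<open>Q\<close>, \<open>P\<close>, \<open>T\<close>, each with its
  direction kept. (In terms of the surface that is made from a disc by attaching a band for each
  chord, this is the cutting off of a handle.) Since the pivot block has determinant \<open>1\<close>, the
  claim follows by induction. A number that is known to be \<open>0\<close> or \<open>1\<close> is determined by its parity,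
  and modulo \<open>2\<close> the matrix \<open>M\<close> is just the adjacency matrix of the intersection graph.\<close>

section \<open>Principal minors of integer matrices\<close>

text \<open>The Leibniz formula over an arbitrary finite index set, so that the chords themselves
  can serve as indices and minors on different sets can be compared directly.\<close>

definition principal_minor :: "('a \<Rightarrow> 'a \<Rightarrow> int) \<Rightarrow> 'a set \<Rightarrow> int" where
  "principal_minor M S = (\<Sum>p | p permutes S. sign p * (\<Prod>i\<in>S. M i (p i)))"

lemma principal_minor_empty [simp]: "principal_minor M {} = 1"
  by (simp add: principal_minor_def)

lemma principal_minor_cong:
  assumes "\<And>i j. i \<in> S \<Longrightarrow> j \<in> S \<Longrightarrow> M i j = N i j"
  shows "principal_minor M S = principal_minor N S"
  unfolding principal_minor_def using assms
  by (intro sum.cong prod.cong arg_cong2[where f="(*)"] refl) (auto simp: permutes_in_image)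

lemma principal_minor_mod_cong:
  assumes "\<And>i j. i \<in> S \<Longrightarrow> j \<in> S \<Longrightarrow> M i j mod m = N i j mod m"
  shows "principal_minor M S mod m = principal_minor N S mod m"
proof -
  have "(\<Prod>i\<in>S. M i (p i)) mod m = (\<Prod>i\<in>S. N i (p i)) mod m" if "p permutes S" for p
  proof -
    have "(\<Prod>i\<in>S. M i (p i)) mod m = (\<Prod>i\<in>S. M i (p i) mod m) mod m"
      by (rule mod_prod_eq[symmetric])
    also have "\<dots> = (\<Prod>i\<in>S. N i (p i) mod m) mod m"
      using assms that by (simp add: permutes_in_image cong: prod.cong)
    finally show ?thesis by (simp add: mod_prod_eq)
  qed
  then have "(\<Sum>p | p permutes S. sign p * (\<Prod>i\<in>S. M i (p i)) mod m)
    = (\<Sum>p | p permutes S. sign p * (\<Prod>i\<in>S. N i (p i)) mod m)"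
    by (intro sum.cong refl mod_mult_cong) auto
  from arg_cong[OF this, of "\<lambda>x. x mod m"] show ?thesis
    unfolding principal_minor_def by (simp only: mod_sum_eq)
qed

lemma principal_minor_zero_row:
  assumes "finite S" "i \<in> S" "\<And>j. j \<in> S \<Longrightarrow> M i j = 0"
  shows "principal_minor M S = 0"
  unfolding principal_minor_def
proof (intro sum.neutral ballI)
  fix p assume "p \<in> {p. p permutes S}"
  then have "M i (p i) = 0" using assms by (auto simp: permutes_in_image)
  then show "sign p * (\<Prod>i\<in>S. M i (p i)) = 0" using assms by (auto intro!: prod_zero)
qed

lemma principal_minor_transpose:
  assumes "finite S"
  shows "principal_minor (\<lambda>i j. M j i) S = principal_minor M S"
proof -
  have "principal_minor M S = (\<Sum>p | p permutes S. sign (inv p) * (\<Prod>i\<in>S. M i (inv p i)))"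
    unfolding principal_minor_def by (rule sum_permutations_inverse)
  also have "\<dots> = (\<Sum>p | p permutes S. sign p * (\<Prod>i\<in>S. M (p i) i))"
  proof (rule sum.cong)
    fix p assume "p \<in> {p. p permutes S}"
    then have p: "p permutes S" by simp
    have "(\<Prod>i\<in>S. M i (inv p i)) = (\<Prod>i\<in>S. M (p i) i)"
      using prod.permute[OF p, of "\<lambda>i. M i (inv p i)"] permutes_inverses[OF p] by (simp add: o_def)
    then show "sign (inv p) * (\<Prod>i\<in>S. M i (inv p i)) = sign p * (\<Prod>i\<in>S. M (p i) i)"
      using sign_inverse[OF permutes_imp_permutation[OF assms p]] by simp
  qed simp
  finally show ?thesis by (simp add: principal_minor_def)
qed

lemma principal_minor_equal_columns:
  assumes "finite S" "i \<in> S" "j \<in> S" "i \<noteq> j" and eq: "\<And>k. M k i = M k j"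
  shows "principal_minor M S = 0"
proof -
  let ?t = "Transposition.transpose i j"
  have t: "?t permutes S" using assms by (simp add: permutes_swap_id)
  have "principal_minor M S
      = (\<Sum>p | p permutes S. sign (?t \<circ> p) * (\<Prod>k\<in>S. M k ((?t \<circ> p) k)))"
    unfolding principal_minor_def by (rule setum_permutations_compose_left[OF t])
  also have "\<dots> = (\<Sum>p | p permutes S. - (sign p * (\<Prod>k\<in>S. M k (p k))))"
  proof (rule sum.cong)
    fix p assume "p \<in> {p. p permutes S}"
    then have p: "permutation p" using permutes_imp_permutation assms by blast
    have "M k (?t x) = M k x" for k x using eq by (auto simp: Transposition.transpose_def)
    then show "sign (?t \<circ> p) * (\<Prod>k\<in>S. M k ((?t \<circ> p) k)) = - (sign p * (\<Prod>k\<in>S. M k (p k)))"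
      using sign_compose[OF permutation_swap_id p, of i j] assms by (simp add: sign_swap_id)
  qed simp
  finally show ?thesis by (simp add: principal_minor_def sum_negf)
qed

lemma principal_minor_equal_rows:
  assumes "finite S" "i \<in> S" "j \<in> S" "i \<noteq> j" and eq: "\<And>k. M i k = M j k"
  shows "principal_minor M S = 0"
  using principal_minor_equal_columns[of S i j "\<lambda>k l. M l k"] principal_minor_transpose[of S M] assms
  by simp

lemma principal_minor_add_row:
  assumes "finite S" "i \<in> S" "j \<in> S" "i \<noteq> j"
  shows "principal_minor (\<lambda>k l. if k = i then M i l + c * M j l else M k l) S = principal_minor M S"
proof -
  let ?N = "\<lambda>k l. if k = i then M j l else M k l"
  have "principal_minor (\<lambda>k l. if k = i then M i l + c * M j l else M k l) S
      = principal_minor M S + c * principal_minor ?N S"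
    unfolding principal_minor_def sum_distrib_left sum.distrib[symmetric]
  proof (rule sum.cong)
    fix p
    show "sign p * (\<Prod>k\<in>S. if k = i then M i (p k) + c * M j (p k) else M k (p k))
       = sign p * (\<Prod>k\<in>S. M k (p k)) + c * (sign p * (\<Prod>k\<in>S. ?N k (p k)))"
      using assms by (simp add: prod.remove[of S i] algebra_simps)
  qed simp
  moreover have "principal_minor ?N S = 0"
    by (rule principal_minor_equal_rows[OF assms]) auto
  ultimately show ?thesis by simp
qed

lemma principal_minor_add_row_multiples:
  assumes "finite S" "j \<in> S" "T \<subseteq> S - {j}"
  shows "principal_minor (\<lambda>k l. if k \<in> T then M k l + c k * M j l else M k l) S = principal_minor M S"
proof -
  have "finite T" using assms finite_subset by blast
  then show ?thesis using assms(3)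
  proof (induction T)
    case (insert i T)
    let ?N = "\<lambda>k l. if k \<in> T then M k l + c k * M j l else M k l"
    have "principal_minor (\<lambda>k l. if k \<in> insert i T then M k l + c k * M j l else M k l) S
       = principal_minor (\<lambda>k l. if k = i then ?N i l + c i * ?N j l else ?N k l) S"
      using insert by (intro principal_minor_cong) auto
    also have "\<dots> = principal_minor ?N S"
      using insert.prems assms by (intro principal_minor_add_row) auto
    finally show ?case using insert by simp
  qed simp
qed

text \<open>In the Leibniz formula only permutations that swap \<open>a\<close> and \<open>b\<close> survive: the only entry of row \<open>a\<close>
  that may differ from \<open>0\<close> is in column \<open>b\<close>, and then row \<open>b\<close> is left with column \<open>a\<close>.\<close>

lemma principal_minor_block:
  assumes "finite S" "a \<notin> S" "b \<notin> S" "a \<noteq> b" "M a a = 0"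
    and zero: "\<And>j. j \<in> S \<Longrightarrow> M a j = 0" "\<And>j. j \<in> S \<Longrightarrow> M b j = 0"
  shows "principal_minor M (insert a (insert b S)) = - M a b * M b a * principal_minor M S"
proof -
  let ?f = "\<lambda>p. sign p * (\<Prod>i\<in>insert a (insert b S). M i (p i))"
  have neutral: "(\<Sum>q | q permutes insert b S. ?f (Transposition.transpose a x \<circ> q)) = 0" if "x \<in> insert a S" for x
  proof (intro sum.neutral ballI)
    fix q assume "q \<in> {q. q permutes insert b S}"
    then have "q a = a" using assms by (auto simp: permutes_def)
    then have "M a ((Transposition.transpose a x \<circ> q) a) = 0" using that assms by auto
    then show "?f (Transposition.transpose a x \<circ> q) = 0" using assms by simp
  qed
  have "principal_minor M (insert a (insert b S))
    = (\<Sum>x\<in>insert a (insert b S). \<Sum>q | q permutes insert b S. ?f (Transposition.transpose a x \<circ> q))"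
    unfolding principal_minor_def by (rule sum_over_permutations_insert) (use assms in auto)
  also have "\<dots> = (\<Sum>x\<in>{b}. \<Sum>q | q permutes insert b S. ?f (Transposition.transpose a x \<circ> q))"
    using assms by (intro sum.mono_neutral_right ballI neutral) auto
  also have "\<dots> = (\<Sum>q | q permutes insert b S. ?f (Transposition.transpose a b \<circ> q))" by simp
  also have "\<dots> = (\<Sum>y\<in>insert b S. \<Sum>q | q permutes S. ?f (Transposition.transpose a b \<circ> (Transposition.transpose b y \<circ> q)))"
    by (rule sum_over_permutations_insert) (use assms in auto)
  also have "\<dots> = (\<Sum>y\<in>{b}. \<Sum>q | q permutes S. ?f (Transposition.transpose a b \<circ> (Transposition.transpose b y \<circ> q)))"
  proof (intro sum.mono_neutral_right ballI)
    fix y assume y: "y \<in> insert b S - {b}"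
    show "(\<Sum>q | q permutes S. ?f (Transposition.transpose a b \<circ> (Transposition.transpose b y \<circ> q))) = 0"
    proof (intro sum.neutral ballI)
      fix q assume "q \<in> {q. q permutes S}"
      then have "q b = b" using assms by (auto simp: permutes_def)
      then have "M b ((Transposition.transpose a b \<circ> (Transposition.transpose b y \<circ> q)) b) = 0"
        using y assms by (auto simp: Transposition.transpose_def)
      then show "?f (Transposition.transpose a b \<circ> (Transposition.transpose b y \<circ> q)) = 0" using assms by simp
    qed
  qed (use assms in auto)
  also have "\<dots> = (\<Sum>q | q permutes S. - M a b * M b a * (sign q * (\<Prod>i\<in>S. M i (q i))))"
    unfolding sum.insert_if[OF finite.emptyI] sum.empty
  proof (simp, rule sum.cong)
    fix q assume "q \<in> {q. q permutes S}"
    then have q: "q permutes S" by simp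
    have fix_ab: "q a = a" "q b = b" using q assms by (auto simp: permutes_def)
    have "(\<Prod>i\<in>S. M i (Transposition.transpose a b (q i))) = (\<Prod>i\<in>S. M i (q i))"
    proof (rule prod.cong)
      fix i assume "i \<in> S"
      then have "q i \<in> S" using q by (simp add: permutes_in_image)
      then have "q i \<noteq> a" "q i \<noteq> b" using assms by auto
      then show "M i (Transposition.transpose a b (q i)) = M i (q i)" by simp
    qed simp
    moreover have "sign (Transposition.transpose a b \<circ> q) = - sign q"
      using sign_compose[OF permutation_swap_id permutes_imp_permutation[OF \<open>finite S\<close> q], of a b] assms
      by (simp add: sign_swap_id)
    ultimately show "sign (Transposition.transpose a b \<circ> q) *
          (\<Prod>i\<in>insert a (insert b S). M i (Transposition.transpose a b (q i))) =
         - (M a b * M b a * (sign q * (\<Prod>i\<in>S. M i (q i))))"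
      using assms fix_ab by simp
  qed simp
  also have "\<dots> = - M a b * M b a * principal_minor M S"
    by (simp only: principal_minor_def sum_distrib_left)
  finally show ?thesis .
qed

text \<open>The Schur complement of the block on \<open>{a, b}\<close>. Skew symmetry makes the diagonal of this block
  vanish, and so its determinant is \<open>M a b * M a b = 1\<close>.\<close>

lemma principal_minor_pivot:
  assumes S: "finite S" "a \<notin> S" "b \<notin> S" "a \<noteq> b"
    and skew: "\<And>i j. i \<in> insert a (insert b S) \<Longrightarrow> j \<in> insert a (insert b S) \<Longrightarrow> M j i = - M i j"
    and unit: "M a b * M a b = 1"
  shows "principal_minor M (insert a (insert b S))
    = principal_minor (\<lambda>i j. M i j - M a b * (M i b * M a j - M i a * M b j)) S"
proof -
  let ?m = "M a b" and ?U = "insert a (insert b S)"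
  \<comment> \<open>\<open>?L\<close> clears column \<open>b\<close> outside the pivot block with the help of row \<open>a\<close>, and \<open>?N\<close> then clears column \<open>a\<close>
    with the help of row \<open>b\<close>.\<close>
  let ?L = "\<lambda>i j. if i \<in> S then M i j + (- ?m * M i b) * M a j else M i j"
  let ?N = "\<lambda>i j. if i \<in> S then ?L i j + (?m * M i a) * ?L b j else ?L i j"
  have diag: "M a a = 0" "M b b = 0" using skew[of a a] skew[of b b] by auto
  have ba: "M b a = - ?m" using skew[of a b] by simp
  have "principal_minor M ?U = principal_minor ?L ?U"
    using S by (intro principal_minor_add_row_multiples[symmetric]) auto
  also have "\<dots> = principal_minor ?N ?U"
    using S by (intro principal_minor_add_row_multiples[symmetric]) auto
  also have "\<dots> = principal_minor (\<lambda>i j. ?N j i) ?U"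
    using S by (intro principal_minor_transpose[symmetric]) auto
  also have "\<dots> = - ?N b a * ?N a b * principal_minor (\<lambda>i j. ?N j i) S"
  proof (rule principal_minor_block)
    have unit': "M a b * (M a b * x) = x" for x using unit by (simp flip: mult.assoc)
    show "?N j a = 0" if "j \<in> S" for j
      using that S diag ba unit' by (simp add: algebra_simps)
    show "?N j b = 0" if "j \<in> S" for j
      using that S diag ba unit' by (simp add: algebra_simps)
  qed (use S diag in auto)
  also have "\<dots> = principal_minor ?N S"
    using S ba unit by (subst principal_minor_transpose) auto
  also have "\<dots> = principal_minor (\<lambda>i j. M i j - ?m * (M i b * M a j - M i a * M b j)) S"
    using S by (intro principal_minor_cong) (auto simp: algebra_simps)
  finally show ?thesis .
qed

section \<open>Principal minors and sums over Hamiltonian cycles\<close>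

fun path_weight :: "('a \<Rightarrow> 'a \<Rightarrow> int) \<Rightarrow> 'a \<Rightarrow> 'a list \<Rightarrow> 'a \<Rightarrow> int" where
  "path_weight M x [] y = M x y"
| "path_weight M x (v # vs) y = M x v * path_weight M v vs y"

text \<open>The determinant with row indices \<open>insert x S\<close> and column indices \<open>insert y S\<close>, where column \<open>y\<close>
  takes the place of column \<open>x\<close>. Its expansion runs over the paths from \<open>x\<close> to \<open>y\<close> through \<open>S\<close>. The value \<open>y = x\<close>
  is allowed, and then it is an ordinary principal minor.\<close>

definition bordered_minor :: "('a \<Rightarrow> 'a \<Rightarrow> int) \<Rightarrow> 'a set \<Rightarrow> 'a \<Rightarrow> 'a \<Rightarrow> int" where
  "bordered_minor M S x y = principal_minor (\<lambda>i j. if j = x then M i y else M i j) (insert x S)"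

text \<open>Permutations are sorted by the image of \<open>x\<close>. If it is \<open>z\<close>, then composing with the
  transposition of \<open>x\<close> and \<open>z\<close> removes \<open>x\<close> from its cycle, at the cost of a sign, and leaves a path that
  starts at \<open>z\<close>.\<close>

lemma bordered_minor_row_expansion:
  assumes "finite S" "x \<notin> S"
  shows "bordered_minor M S x y
    = M x y * principal_minor M S - (\<Sum>z\<in>S. M x z * bordered_minor M (S - {z}) z y)"
proof -
  let ?N = "\<lambda>x i j. if j = x then M i y else M i j"
  let ?f = "\<lambda>p. sign p * (\<Prod>i\<in>insert x S. ?N x i (p i))"
  have "bordered_minor M S x y = (\<Sum>z\<in>insert x S. \<Sum>q | q permutes S. ?f (Transposition.transpose x z \<circ> q))"
    unfolding bordered_minor_def principal_minor_def
    by (rule sum_over_permutations_insert[OF assms])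
  also have "\<dots> = (\<Sum>q | q permutes S. ?f q) + (\<Sum>z\<in>S. \<Sum>q | q permutes S. ?f (Transposition.transpose x z \<circ> q))"
    using assms by (simp only: sum.insert Transposition.transpose_same id_comp not_False_eq_True)
  finally have split: "bordered_minor M S x y = (\<Sum>q | q permutes S. ?f q)
      + (\<Sum>z\<in>S. \<Sum>q | q permutes S. ?f (Transposition.transpose x z \<circ> q))" .
  have fixed: "(\<Sum>q | q permutes S. ?f q) = M x y * principal_minor M S"
    unfolding principal_minor_def sum_distrib_left
  proof (rule sum.cong)
    fix q assume "q \<in> {q. q permutes S}"
    then have q: "q permutes S" by simp
    have "q x = x" using q assms by (auto simp: permutes_def)
    moreover have "q i \<noteq> x" if "i \<in> S" for i using q that assms by (metis permutes_in_image)
    ultimately show "?f q = M x y * (sign q * (\<Prod>i\<in>S. M i (q i)))"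
      using assms by simp
  qed simp
  have moved: "(\<Sum>z\<in>S. \<Sum>q | q permutes S. ?f (Transposition.transpose x z \<circ> q))
    = (\<Sum>z\<in>S. - (M x z * bordered_minor M (S - {z}) z y))"
  proof (rule sum.cong)
    fix z assume z: "z \<in> S"
    then have ins: "insert z (S - {z}) = S" and xz: "x \<noteq> z" using assms by auto
    have step: "?f (Transposition.transpose x z \<circ> q) = - (M x z * (sign q * (\<Prod>i\<in>S. ?N z i (q i))))"
      if q: "q permutes S" for q
    proof -
      have "q x = x" using q assms by (auto simp: permutes_def)
      moreover have "?N x i (Transposition.transpose x z (q i)) = ?N z i (q i)" if "i \<in> S" for i
      proof -
        have "q i \<noteq> x" using q that assms by (metis permutes_in_image)
        then show ?thesis using xz by (auto simp: Transposition.transpose_def)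
      qed
      moreover have "sign (Transposition.transpose x z \<circ> q) = - sign q"
        using sign_compose[OF permutation_swap_id permutes_imp_permutation[OF \<open>finite S\<close> q], of x z] xz
        by (simp add: sign_swap_id)
      ultimately show ?thesis using assms xz by (simp cong: if_cong)
    qed
    have "(\<Sum>q | q permutes S. ?f (Transposition.transpose x z \<circ> q))
        = (\<Sum>q | q permutes S. - (M x z * (sign q * (\<Prod>i\<in>S. ?N z i (q i)))))"
      by (rule sum.cong[OF refl], rule step) simp
    then show "(\<Sum>q | q permutes S. ?f (Transposition.transpose x z \<circ> q)) = - (M x z * bordered_minor M (S - {z}) z y)"
      by (simp only: bordered_minor_def principal_minor_def ins sum_distrib_left sum_negf)
  qed simp
  show ?thesis unfolding split fixed moved by (simp add: sum_negf)
qed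

lemma finite_distinct_lists: "finite S \<Longrightarrow> finite {vs. distinct vs \<and> set vs \<subseteq> S}"
  using finite_subset_distinct[of S] by (simp add: conj_commute)

lemma distinct_lists_Cons:
  "{vs. distinct vs \<and> set vs \<subseteq> S}
     = insert [] (\<Union>z\<in>S. (#) z ` {vs. distinct vs \<and> set vs \<subseteq> S - {z}})" (is "?l = ?r")
proof
  show "?l \<subseteq> ?r"
  proof
    fix vs assume "vs \<in> ?l"
    then show "vs \<in> ?r" by (cases vs) auto
  qed
qed auto

lemma bordered_minor_path_expansion:
  assumes "finite S" "x \<notin> S"
  shows "bordered_minor M S x y = (\<Sum>vs | distinct vs \<and> set vs \<subseteq> S.
           (-1) ^ length vs * path_weight M x vs y * principal_minor M (S - set vs))"
  using assms
proof (induction "card S" arbitrary: S x rule: less_induct)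
  case less
  let ?L = "\<lambda>S. {vs. distinct vs \<and> set vs \<subseteq> S}"
  let ?g = "\<lambda>S x vs. (-1) ^ length vs * path_weight M x vs y * principal_minor M (S - set vs)"
  have "(\<Sum>vs\<in>?L S. ?g S x vs) = ?g S x [] + (\<Sum>vs\<in>(\<Union>z\<in>S. (#) z ` ?L (S - {z})). ?g S x vs)"
    using less.prems
    by (subst distinct_lists_Cons, subst sum.insert) (auto simp: finite_distinct_lists)
  also have "(\<Sum>vs\<in>(\<Union>z\<in>S. (#) z ` ?L (S - {z})). ?g S x vs)
      = (\<Sum>z\<in>S. \<Sum>vs\<in>(#) z ` ?L (S - {z}). ?g S x vs)"
    using less.prems by (intro sum.UNION_disjoint) (auto simp: finite_distinct_lists)
  also have "\<dots> = (\<Sum>z\<in>S. - (M x z * bordered_minor M (S - {z}) z y))"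
  proof (rule sum.cong)
    fix z assume z: "z \<in> S"
    have "(\<Sum>vs\<in>(#) z ` ?L (S - {z}). ?g S x vs) = (\<Sum>vs\<in>?L (S - {z}). ?g S x (z # vs))"
      by (subst sum.reindex) (auto simp: inj_on_def)
    also have "\<dots> = (\<Sum>vs\<in>?L (S - {z}). - (M x z * ?g (S - {z}) z vs))"
    proof (rule sum.cong)
      fix vs
      have "S - set (z # vs) = S - {z} - set vs" by auto
      then show "?g S x (z # vs) = - (M x z * ?g (S - {z}) z vs)" by simp
    qed simp
    also have "\<dots> = - (M x z * bordered_minor M (S - {z}) z y)"
      using less.prems z by (subst less.hyps) (auto simp: sum_distrib_left sum_negf intro!: card_Diff1_less simp del: card_Diff_insert card_Diff_singleton)
    finally show "(\<Sum>vs\<in>(#) z ` ?L (S - {z}). ?g S x vs) = - (M x z * bordered_minor M (S - {z}) z y)" .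
  qed simp
  finally show ?case
    by (subst bordered_minor_row_expansion[OF less.prems]) (simp add: sum_negf)
qed

text \<open>The lists \<open>vs\<close> are the possible cycles \<open>s # vs\<close> through \<open>s\<close> in a permutation of \<open>insert s S\<close>.\<close>

lemma principal_minor_cycle_expansion:
  assumes "finite S" "s \<notin> S"
  shows "principal_minor M (insert s S) = (\<Sum>vs | distinct vs \<and> set vs \<subseteq> S.
           (-1) ^ length vs * path_weight M s vs s * principal_minor M (S - set vs))"
proof -
  have "(\<lambda>i j. if j = s then M i s else M i j) = M" by (intro ext) simp
  then show ?thesis
    using bordered_minor_path_expansion[OF assms, of M s] by (simp add: bordered_minor_def)
qed

definition hamiltonian_sum :: "('a \<Rightarrow> 'a \<Rightarrow> int) \<Rightarrow> 'a \<Rightarrow> 'a set \<Rightarrow> int" where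
  "hamiltonian_sum M s T = (\<Sum>vs | distinct vs \<and> set vs = T. path_weight M s vs s)"

lemma principal_minor_hamiltonian_expansion:
  assumes "finite S" "s \<notin> S"
  shows "principal_minor M (insert s S)
    = (\<Sum>T\<in>Pow S. (-1) ^ card T * hamiltonian_sum M s T * principal_minor M (S - T))"
proof -
  let ?L = "{vs. distinct vs \<and> set vs \<subseteq> S}"
  have img: "set ` ?L = Pow S"
  proof -
    have "T \<in> set ` ?L" if "T \<subseteq> S" for T
      using finite_distinct_list[of T] that assms finite_subset by (metis (mono_tags) image_eqI mem_Collect_eq)
    then show ?thesis by auto
  qed
  have "principal_minor M (insert s S) = (\<Sum>T\<in>Pow S. \<Sum>vs | vs \<in> ?L \<and> set vs = T.
           (-1) ^ length vs * path_weight M s vs s * principal_minor M (S - set vs))"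
    unfolding principal_minor_cycle_expansion[OF assms]
    by (subst sum.image_gen[where g=set]) (use assms img in \<open>auto simp: finite_distinct_lists\<close>)
  also have "\<dots> = (\<Sum>T\<in>Pow S. (-1) ^ card T * hamiltonian_sum M s T * principal_minor M (S - T))"
  proof (rule sum.cong)
    fix T assume "T \<in> Pow S"
    then have eq: "{vs. vs \<in> ?L \<and> set vs = T} = {vs. distinct vs \<and> set vs = T}" by auto
    show "(\<Sum>vs | vs \<in> ?L \<and> set vs = T.
           (-1) ^ length vs * path_weight M s vs s * principal_minor M (S - set vs))
        = (-1) ^ card T * hamiltonian_sum M s T * principal_minor M (S - T)"
      unfolding eq hamiltonian_sum_def sum_distrib_left sum_distrib_right
      by (rule sum.cong) (auto simp: distinct_card)
  qed simp
  finally show ?thesis .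
qed

text \<open>In the expansion of the minor on \<open>insert s S\<close> the term for \<open>T = S\<close> is \<open>hamiltonian_sum M s S\<close> up
  to sign, because the empty minor is \<open>1\<close>; all other terms are known by induction.\<close>

lemma hamiltonian_sum_determined_by_minors:
  assumes "finite S" "s \<notin> S"
    and minors: "\<And>T. T \<subseteq> insert s S \<Longrightarrow> principal_minor M T = principal_minor N T"
  shows "hamiltonian_sum M s S = hamiltonian_sum N s S"
  using assms
proof (induction "card S" arbitrary: S rule: less_induct)
  case less
  let ?rest = "\<lambda>M. \<Sum>T\<in>Pow S - {S}. (-1) ^ card T * hamiltonian_sum M s T * principal_minor M (S - T)"
  have split: "principal_minor M (insert s S) = (-1) ^ card S * hamiltonian_sum M s S + ?rest M" for M
    using less.prems(1,2) by (simp add: principal_minor_hamiltonian_expansion sum.remove[of "Pow S" S])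
  have "?rest M = ?rest N"
  proof (rule sum.cong)
    fix T assume T: "T \<in> Pow S - {S}"
    then have "card T < card S" using less.prems(1) by (auto intro: psubset_card_mono)
    then have "hamiltonian_sum M s T = hamiltonian_sum N s T"
      using T less.prems by (intro less.hyps) (auto intro: finite_subset)
    moreover have "principal_minor M (S - T) = principal_minor N (S - T)"
      by (rule less.prems) auto
    ultimately show "(-1) ^ card T * hamiltonian_sum M s T * principal_minor M (S - T)
        = (-1) ^ card T * hamiltonian_sum N s T * principal_minor N (S - T)" by simp
  qed simp
  then have "(-1) ^ card S * hamiltonian_sum M s S = (-1) ^ card S * hamiltonian_sum N s S"
    using split[of M] split[of N] less.prems(3)[of "insert s S"] by simp
  then show ?case by simp
qed

definition cycle_weight :: "('a \<Rightarrow> 'a \<Rightarrow> int) \<Rightarrow> 'a list \<Rightarrow> int" where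
  "cycle_weight M vs = (\<Prod>i<length vs. M (vs ! i) (vs ! (Suc i mod length vs)))"

definition distinct_lists :: "'a set \<Rightarrow> nat \<Rightarrow> 'a list set" where
  "distinct_lists V m = {vs. distinct vs \<and> set vs \<subseteq> V \<and> length vs = m}"

lemma finite_distinct_lists_length: "finite V \<Longrightarrow> finite (distinct_lists V m)"
  unfolding distinct_lists_def by (rule finite_subset[OF _ finite_distinct_lists[of V]]) auto

lemma path_weight_eq_prod:
  "path_weight M x vs y = (\<Prod>i<Suc (length vs). M ((x # vs) ! i) ((vs @ [y]) ! i))"
proof (induction vs arbitrary: x)
  case (Cons v vs)
  show ?case
    unfolding path_weight.simps Cons.IH length_Cons
    by (subst (2) prod.lessThan_Suc_shift) simp
qed simp

lemma cycle_weight_Cons: "cycle_weight M (s # vs) = path_weight M s vs s"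
proof -
  have "(s # vs) ! (Suc i mod Suc (length vs)) = (vs @ [s]) ! i" if "i < Suc (length vs)" for i
    using that by (cases "i = length vs") (auto simp: nth_append)
  then show ?thesis
    unfolding path_weight_eq_prod cycle_weight_def length_Cons by (intro prod.cong) auto
qed

lemma cycle_weight_map: "cycle_weight M (map f vs) = cycle_weight (\<lambda>x y. M (f x) (f y)) vs"
proof -
  have "Suc i mod length vs < length vs" if "i < length vs" for i
    using that by (intro mod_less_divisor) auto
  then show ?thesis unfolding cycle_weight_def by (intro prod.cong) auto
qed

lemma cycle_weight_cong:
  assumes "set vs \<subseteq> V" "\<And>x y. x \<in> V \<Longrightarrow> y \<in> V \<Longrightarrow> M x y = N x y"
  shows "cycle_weight M vs = cycle_weight N vs"
  unfolding cycle_weight_def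
proof (rule prod.cong[OF refl])
  fix i assume "i \<in> {..<length vs}"
  then have "vs ! i \<in> set vs" "vs ! (Suc i mod length vs) \<in> set vs"
    by (auto intro!: nth_mem mod_less_divisor)
  then show "M (vs ! i) (vs ! (Suc i mod length vs)) = N (vs ! i) (vs ! (Suc i mod length vs))"
    using assms by blast
qed

lemma distinct_lists_image:
  assumes "inj_on f V"
  shows "distinct_lists (f ` V) m = map f ` distinct_lists V m"
proof
  show "map f ` distinct_lists V m \<subseteq> distinct_lists (f ` V) m"
  proof
    fix ys assume "ys \<in> map f ` distinct_lists V m"
    then obtain xs where xs: "ys = map f xs" "distinct xs" "set xs \<subseteq> V" "length xs = m"
      by (auto simp: distinct_lists_def)
    then have "inj_on f (set xs)" using assms inj_on_subset by blast
    then show "ys \<in> distinct_lists (f ` V) m" using xs by (auto simp: distinct_lists_def distinct_map)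
  qed
  show "distinct_lists (f ` V) m \<subseteq> map f ` distinct_lists V m"
  proof
    fix ys assume ys: "ys \<in> distinct_lists (f ` V) m"
    then have "ys \<in> lists (f ` V)" by (simp add: distinct_lists_def lists_eq_set)
    then have "ys \<in> map f ` lists V" by (simp only: lists_image)
    then obtain xs where xs: "ys = map f xs" "set xs \<subseteq> V"
      by (auto simp: lists_eq_set)
    then have "xs \<in> distinct_lists V m" using ys by (auto simp: distinct_lists_def distinct_map)
    then show "ys \<in> map f ` distinct_lists V m" using xs by blast
  qed
qed

lemma sum_cycle_weight_image:
  assumes "inj_on f V"
  shows "sum (cycle_weight M) (distinct_lists (f ` V) m)
    = sum (cycle_weight (\<lambda>x y. M (f x) (f y))) (distinct_lists V m)"
proof -
  have "inj_on (map f) (distinct_lists V m)"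
    by (rule inj_on_mapI, rule inj_on_subset[OF assms]) (auto simp: distinct_lists_def)
  then show ?thesis
    unfolding distinct_lists_image[OF assms] by (simp add: sum.reindex cycle_weight_map)
qed

text \<open>A list is split into its first vertex and the set of the remaining ones. The sum over each
  class is one of the sums determined above.\<close>

lemma cycle_weight_sum_determined_by_minors:
  assumes "finite V" "m > 0"
    and minors: "\<And>T. T \<subseteq> V \<Longrightarrow> principal_minor M T = principal_minor N T"
  shows "sum (cycle_weight M) (distinct_lists V m) = sum (cycle_weight N) (distinct_lists V m)"
proof -
  let ?U = "distinct_lists V m"
  let ?g = "\<lambda>us. (hd us, set (tl us))"
  have fin: "finite ?U" using assms by (simp add: finite_distinct_lists_length)
  have "(\<Sum>us | us \<in> ?U \<and> ?g us = y. cycle_weight M us) = (\<Sum>us | us \<in> ?U \<and> ?g us = y. cycle_weight N us)"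
    if "y \<in> ?g ` ?U" for y
  proof -
    obtain us where us: "us \<in> ?U" "y = ?g us" using \<open>y \<in> _\<close> by blast
    then obtain s vs where vs: "us = s # vs" "distinct (s # vs)" "set (s # vs) \<subseteq> V" "Suc (length vs) = m"
      using \<open>m > 0\<close> by (cases us) (auto simp: distinct_lists_def)
    define T where "T = set vs"
    have T: "finite T" "s \<notin> T" "insert s T \<subseteq> V" "Suc (card T) = m"
      using vs by (auto simp: T_def distinct_card)
    have fibre: "{us. us \<in> ?U \<and> ?g us = y} = (#) s ` {ws. distinct ws \<and> set ws = T}" (is "?l = ?r")
    proof
      show "?l \<subseteq> ?r"
      proof
        fix ws assume "ws \<in> ?l"
        then show "ws \<in> ?r"
          using us(2) vs(1) \<open>m > 0\<close> by (cases ws) (auto simp: distinct_lists_def T_def)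
      qed
      have "length ws = card T" if "distinct ws" "set ws = T" for ws :: "'a list"
        using that distinct_card by metis
      then show "?r \<subseteq> ?l" using us(2) vs(1) T by (auto simp: distinct_lists_def T_def)
    qed
    have "(\<Sum>us | us \<in> ?U \<and> ?g us = y. cycle_weight K us) = hamiltonian_sum K s T" for K
      unfolding fibre hamiltonian_sum_def by (subst sum.reindex) (auto simp: cycle_weight_Cons)
    moreover have "hamiltonian_sum M s T = hamiltonian_sum N s T"
      using T minors by (intro hamiltonian_sum_determined_by_minors) auto
    ultimately show ?thesis by simp
  qed
  then show ?thesis
    unfolding sum.image_gen[OF fin, of _ ?g] by (rule sum.cong[OF refl])
qed

section \<open>Circuits and their traversals\<close>

definition arcs :: "'a list \<Rightarrow> ('a \<times> 'a) set" where
  "arcs vs = (\<lambda>i. (vs ! i, vs ! (Suc i mod length vs))) ` {..<length vs}"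

lemma inj_on_arcs:
  assumes "distinct vs"
  shows "inj_on (\<lambda>i. (vs ! i, vs ! (Suc i mod length vs))) {..<length vs}"
  using assms by (auto simp: inj_on_def nth_eq_iff_index_eq)

lemma card_arcs: "distinct vs \<Longrightarrow> card (arcs vs) = length vs"
  unfolding arcs_def by (simp add: card_image inj_on_arcs)

lemma cycle_weight_eq_prod_arcs:
  "distinct vs \<Longrightarrow> cycle_weight M vs = (\<Prod>(x, y)\<in>arcs vs. M x y)"
  unfolding arcs_def cycle_weight_def by (subst prod.reindex) (auto simp: inj_on_arcs)

lemma traversed_edges_eq_arcs: "traversed_edges vs = (\<lambda>(x, y). {x, y}) ` arcs vs"
  unfolding traversed_edges_def arcs_def by (auto simp: image_image)

lemma arcs_eq_range:
  assumes "vs \<noteq> []"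
  shows "arcs vs = range (\<lambda>i. (vs ! (i mod length vs), vs ! (Suc i mod length vs)))"
proof
  show "arcs vs \<subseteq> range (\<lambda>i. (vs ! (i mod length vs), vs ! (Suc i mod length vs)))"
    unfolding arcs_def by force
  show "range (\<lambda>i. (vs ! (i mod length vs), vs ! (Suc i mod length vs))) \<subseteq> arcs vs"
  proof
    fix a assume "a \<in> range (\<lambda>i. (vs ! (i mod length vs), vs ! (Suc i mod length vs)))"
    then obtain i where "a = (vs ! (i mod length vs), vs ! (Suc (i mod length vs) mod length vs))"
      by (auto simp: mod_Suc_eq)
    moreover have "i mod length vs \<in> {..<length vs}" using assms by simp
    ultimately show "a \<in> arcs vs" unfolding arcs_def by blast
  qed
qed

lemma arcs_single_valued:
  assumes "distinct vs" "(x, y) \<in> arcs vs" "(x, z) \<in> arcs vs"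
  shows "y = z"
  using assms by (auto simp: arcs_def nth_eq_iff_index_eq)

lemma arcs_injective:
  assumes "distinct vs" "(x, z) \<in> arcs vs" "(y, z) \<in> arcs vs"
  shows "x = y"
proof -
  obtain i j where ij: "i < length vs" "j < length vs" "x = vs ! i" "y = vs ! j"
    "z = vs ! (Suc i mod length vs)" "z = vs ! (Suc j mod length vs)"
    using assms by (auto simp: arcs_def)
  then have "Suc i mod length vs = Suc j mod length vs"
    using nth_eq_iff_index_eq[OF assms(1)] by (metis gr_implies_not_zero mod_less_divisor not_gr_zero)
  then have "i = j" using ij(1,2) by (auto simp: mod_Suc split: if_splits)
  then show ?thesis using ij by simp
qed

text \<open>A cycle graph has only two directions of traversal. If \<open>ws\<close> runs through one edge in the same
  direction as \<open>vs\<close>, it must also do so for the next edge of \<open>vs\<close>: otherwise it would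
  enter the common vertex twice. Likewise for the opposite direction.\<close>

lemma arcs_determined_by_edges:
  assumes vs: "distinct vs" "length vs = m" and ws: "distinct ws" "length ws = m" and m: "m \<ge> 3"
    and edges: "traversed_edges vs = traversed_edges ws"
  shows "arcs ws = arcs vs \<or> arcs ws = (arcs vs)\<inverse>"
proof -
  \<comment> \<open>Indexing the cycle by all natural numbers, periodically, makes going around it a plain induction.\<close>
  define c where "c i = vs ! (i mod m)" for i
  have ne: "vs \<noteq> []" using vs m by auto
  have arcs_c: "arcs vs = range (\<lambda>i. (c i, c (Suc i)))"
    unfolding c_def using arcs_eq_range[OF ne] vs by simp
  have edge: "(c i, c (Suc i)) \<in> arcs ws \<or> (c (Suc i), c i) \<in> arcs ws" for i
  proof -
    have "{c i, c (Suc i)} \<in> traversed_edges vs"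
      unfolding traversed_edges_eq_arcs arcs_c
      by (rule rev_image_eqI[of "(c i, c (Suc i))"]) auto
    then have "{c i, c (Suc i)} \<in> traversed_edges ws" by (simp only: edges)
    then show ?thesis unfolding traversed_edges_eq_arcs by (auto simp: doubleton_eq_iff)
  qed
  \<comment> \<open>This is where the length must be at least \<open>3\<close>: consecutive edges are different.\<close>
  have skip: "c (Suc (Suc i)) \<noteq> c i" for i
  proof
    assume "c (Suc (Suc i)) = c i"
    then have "Suc (Suc i) mod m = i mod m"
      using vs m nth_eq_iff_index_eq[of vs "Suc (Suc i) mod m" "i mod m"] by (simp add: c_def)
    then show False using m by (auto simp: mod_Suc split: if_splits)
  qed
  have fwd: "(c (Suc i), c (Suc (Suc i))) \<in> arcs ws" if "(c i, c (Suc i)) \<in> arcs ws" for i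
    using edge[of "Suc i"] skip[of i] arcs_injective[OF ws(1) that] by metis
  have bwd: "(c (Suc (Suc i)), c (Suc i)) \<in> arcs ws" if "(c (Suc i), c i) \<in> arcs ws" for i
    using edge[of "Suc i"] skip[of i] arcs_single_valued[OF ws(1) that] by metis
  have fin: "finite (arcs ws)" "card (arcs vs) = card (arcs ws)"
    using vs ws by (simp_all add: card_arcs) (simp add: arcs_def)
  from edge[of 0] show ?thesis
  proof
    assume 0: "(c 0, c (Suc 0)) \<in> arcs ws"
    have "(c i, c (Suc i)) \<in> arcs ws" for i by (induction i) (auto intro: 0 fwd)
    then have "arcs vs \<subseteq> arcs ws" unfolding arcs_c by blast
    then show ?thesis using card_subset_eq fin by blast
  next
    assume 0: "(c (Suc 0), c 0) \<in> arcs ws"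
    have "(c (Suc i), c i) \<in> arcs ws" for i by (induction i) (auto intro: 0 bwd)
    then have "(arcs vs)\<inverse> \<subseteq> arcs ws" unfolding arcs_c by blast
    then have "(arcs vs)\<inverse> = arcs ws" using card_subset_eq[of "arcs ws" "(arcs vs)\<inverse>"] fin by simp
    then show ?thesis by simp
  qed
qed

text \<open>Reversing the direction changes the sign of each of the evenly many factors.\<close>

lemma cycle_weight_determined_by_edges:
  assumes vs: "distinct vs" "length vs = m" and ws: "distinct ws" "length ws = m"
    and m: "m \<ge> 3" "even m"
    and edges: "traversed_edges vs = traversed_edges ws"
    and skew: "\<And>x y. M y x = - M x y"
  shows "cycle_weight M vs = cycle_weight M ws"
proof -
  consider "arcs ws = arcs vs" | "arcs ws = (arcs vs)\<inverse>"
    using arcs_determined_by_edges[OF vs ws m(1) edges] by blast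
  then show ?thesis
  proof cases
    case 1
    then show ?thesis using vs ws by (simp add: cycle_weight_eq_prod_arcs)
  next
    case 2
    have conv: "(arcs vs)\<inverse> = prod.swap ` arcs vs" by auto
    have "cycle_weight M ws = (\<Prod>(x, y)\<in>arcs vs. M y x)"
      unfolding cycle_weight_eq_prod_arcs[OF ws(1)] 2 conv
      by (subst prod.reindex) (auto simp: case_prod_beta)
    also have "\<dots> = (\<Prod>a\<in>arcs vs. - (case a of (x, y) \<Rightarrow> M x y))"
      by (rule prod.cong[OF refl]) (clarsimp simp: skew[symmetric])
    also have "\<dots> = cycle_weight M vs"
      using vs m by (simp add: prod_uminus card_arcs cycle_weight_eq_prod_arcs)
    finally show ?thesis by simp
  qed
qed

definition arrow_sign :: "'a set set \<Rightarrow> ('a \<Rightarrow> 'a \<Rightarrow> bool) \<Rightarrow> 'a \<Rightarrow> 'a \<Rightarrow> int" where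
  "arrow_sign E D x y = (if {x, y} \<in> E then if D x y then 1 else -1 else 0)"

lemma cycle_weight_arrow_sign:
  assumes "circuit_traversal G m vs" "even m"
  shows "cycle_weight (arrow_sign (snd G) D) vs = (if even (forward_arrows D vs) then 1 else -1)"
proof -
  let ?P = "\<lambda>i. D (vs ! i) (vs ! (Suc i mod m))"
  have len: "length vs = m" and E: "\<And>i. i < m \<Longrightarrow> {vs ! i, vs ! (Suc i mod m)} \<in> snd G"
    using assms by (auto simp: circuit_traversal_def)
  have "cycle_weight (arrow_sign (snd G) D) vs = (\<Prod>i<m. if ?P i then 1 else -1)"
    unfolding cycle_weight_def len by (rule prod.cong) (auto simp: arrow_sign_def E)
  also have "\<dots> = (-1) ^ card ({..<m} \<inter> - {i. ?P i})"
    by (simp add: prod.If_cases)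
  also have "{..<m} \<inter> - {i. ?P i} = {i. i < m \<and> \<not> ?P i}" by blast
  finally have weight: "cycle_weight (arrow_sign (snd G) D) vs = (-1) ^ card {i. i < m \<and> \<not> ?P i}" .
  have "card {i. i < m \<and> ?P i} + card {i. i < m \<and> \<not> ?P i}
      = card ({i. i < m \<and> ?P i} \<union> {i. i < m \<and> \<not> ?P i})"
    by (rule card_Un_disjoint[symmetric]) auto
  also have "{i. i < m \<and> ?P i} \<union> {i. i < m \<and> \<not> ?P i} = {..<m}" by auto
  finally have "even (card {i. i < m \<and> ?P i} + card {i. i < m \<and> \<not> ?P i})"
    using assms(2) by simp
  then have "even (card {i. i < m \<and> \<not> ?P i}) \<longleftrightarrow> even (forward_arrows D vs)"
    unfolding even_add forward_arrows_def len by (rule sym)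
  then show ?thesis unfolding weight minus_one_power_iff by (rule if_cong) (rule refl)+
qed

text \<open>The definition asks for some traversal with an even number of forward arrows; the parity is the
  same for all traversals, as the sign of the cyclic product shows.\<close>

lemma positively_oriented_iff:
  assumes G: "circuit_traversal G m vs" and m: "m \<ge> 3" "even m"
    and D: "\<And>x y. {x, y} \<in> snd G \<Longrightarrow> D y x \<longleftrightarrow> \<not> D x y"
  shows "positively_oriented G D m (traversed_edges vs) \<longleftrightarrow> even (forward_arrows D vs)"
proof
  let ?M = "arrow_sign (snd G) D"
  have skew: "?M y x = - ?M x y" for x y
    using D[of x y] by (auto simp: arrow_sign_def insert_commute)
  assume "positively_oriented G D m (traversed_edges vs)"
  then obtain ws where ws: "circuit_traversal G m ws" "traversed_edges ws = traversed_edges vs"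
    "even (forward_arrows D ws)" by (auto simp: positively_oriented_def)
  have "cycle_weight ?M vs = cycle_weight ?M ws"
    using G ws m by (intro cycle_weight_determined_by_edges[where m=m] skew) (auto simp: circuit_traversal_def)
  then show "even (forward_arrows D vs)"
    using cycle_weight_arrow_sign[OF G m(2), of D] cycle_weight_arrow_sign[OF ws(1) m(2), of D] ws(3)
    by (auto split: if_splits)
qed (use G in \<open>auto simp: positively_oriented_def\<close>)

lemma circuit_traversal_iff:
  "circuit_traversal G m vs \<longleftrightarrow>
     length vs = m \<and> distinct vs \<and> set vs \<subseteq> fst G \<and> traversed_edges vs \<subseteq> snd G"
  unfolding circuit_traversal_def traversed_edges_def by auto

lemma Union_traversed_edges: "\<Union> (traversed_edges vs) = set vs"
proof
  have "vs ! (Suc i mod length vs) \<in> set vs" if "i < length vs" for i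
    using that by (intro nth_mem mod_less_divisor) auto
  then show "\<Union> (traversed_edges vs) \<subseteq> set vs" by (auto simp: traversed_edges_def)
  show "set vs \<subseteq> \<Union> (traversed_edges vs)"
    by (auto simp: traversed_edges_def in_set_conv_nth) blast
qed

lemma traversed_edges_eq_image:
  "traversed_edges vs = (\<lambda>i. {vs ! i, vs ! (Suc i mod length vs)}) ` {..<length vs}"
  by (auto simp: traversed_edges_def)

lemma traversed_edges_map: "traversed_edges (map f vs) = (`) f ` traversed_edges vs"
proof -
  have "traversed_edges (map f vs)
      = (\<lambda>i. f ` {vs ! i, vs ! (Suc i mod length vs)}) ` {..<length vs}"
    unfolding traversed_edges_eq_image length_map
  proof (rule image_cong[OF refl])
    fix i assume "i \<in> {..<length vs}"
    moreover from this have "Suc i mod length vs < length vs" by (intro mod_less_divisor) auto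
    ultimately show "{map f vs ! i, map f vs ! (Suc i mod length vs)} = f ` {vs ! i, vs ! (Suc i mod length vs)}"
      by simp
  qed
  then show ?thesis by (simp only: traversed_edges_eq_image image_image)
qed

text \<open>The number of traversals of a circuit of length \<open>m\<close>, taken on the model circuit with
  vertices \<open>0, \<dots>, m - 1\<close>. Its value is \<open>2 * m\<close> for \<open>m \<ge> 3\<close>. Below it is divided out,
  and so it is enough to know that it is positive.\<close>

definition traversal_count :: "nat \<Rightarrow> nat" where
  "traversal_count m =
     card {ps. distinct ps \<and> length ps = m \<and> traversed_edges ps = traversed_edges [0..<m]}"

lemma traversal_count_pos: "traversal_count m > 0"
proof -
  let ?P = "{ps. distinct ps \<and> length ps = m \<and> traversed_edges ps = traversed_edges [0..<m]}"
  have "set ps = {0..<m}" if "ps \<in> ?P" for ps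
    using that Union_traversed_edges[of ps] Union_traversed_edges[of "[0..<m]"] by auto
  then have "?P \<subseteq> {ps. distinct ps \<and> set ps \<subseteq> {0..<m}}" by auto
  then have "finite ?P" by (rule finite_subset) (simp add: finite_distinct_lists)
  moreover have "[0..<m] \<in> ?P" by simp
  ultimately show ?thesis unfolding traversal_count_def card_gt_0_iff by blast
qed

text \<open>A traversal \<open>vs\<close> identifies its circuit with the model circuit, and thereby
  identifies the traversals of both.\<close>

lemma card_traversals:
  assumes G: "circuit_traversal G m vs"
  shows "card {us. circuit_traversal G m us \<and> traversed_edges us = traversed_edges vs} = traversal_count m"
proof -
  let ?P = "{ps. distinct ps \<and> length ps = m \<and> traversed_edges ps = traversed_edges [0..<m]}"
  let ?Q = "{us. circuit_traversal G m us \<and> traversed_edges us = traversed_edges vs}"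
  have vs: "distinct vs" "length vs = m" "set vs \<subseteq> fst G" "traversed_edges vs \<subseteq> snd G"
    using G by (auto simp: circuit_traversal_iff)
  have map_vs: "map ((!) vs) [0..<m] = vs" using vs(2) map_nth by blast
  have inj: "inj_on ((!) vs) {0..<m}" using vs by (auto simp: inj_on_def nth_eq_iff_index_eq)
  have setP: "set ps = {0..<m}" if "traversed_edges ps = traversed_edges [0..<m]" for ps
    using that Union_traversed_edges[of ps] Union_traversed_edges[of "[0..<m]"] by auto
  have setQ: "set us = set vs" if "traversed_edges us = traversed_edges vs" for us
    using that Union_traversed_edges[of us] Union_traversed_edges[of vs] by auto
  have "bij_betw (map ((!) vs)) ?P ?Q"
  proof (rule bij_betwI[where g = "map (the_inv_into {0..<m} ((!) vs))"])
    let ?h = "the_inv_into {0..<m} ((!) vs)"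
    have img: "(!) vs ` {0..<m} = set vs" using vs(2) by (metis map_vs set_map set_upt)
    have h_vs: "?h (vs ! i) = i" if "i < m" for i using the_inv_into_f_f[OF inj] that by simp
    have vs_h: "vs ! ?h x = x" if "x \<in> set vs" for x using f_the_inv_into_f[OF inj] that img by simp
    have map_h: "map ?h vs = [0..<m]"
      using h_vs vs(2) by (intro nth_equalityI) auto
    have "inj_on ?h (set vs)" using vs_h by (metis inj_on_inverseI)
    show "map ((!) vs) \<in> ?P \<rightarrow> ?Q"
    proof
      fix ps assume "ps \<in> ?P"
      then have ps: "distinct ps" "length ps = m" "traversed_edges ps = traversed_edges [0..<m]" by auto
      have "traversed_edges (map ((!) vs) ps) = traversed_edges vs"
        using ps(3) traversed_edges_map[of "(!) vs" "[0..<m]"] by (simp add: traversed_edges_map map_vs)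
      moreover from this have "set (map ((!) vs) ps) \<subseteq> fst G" using setQ vs(3) by blast
      moreover have "distinct (map ((!) vs) ps)"
        using ps(1) setP[OF ps(3)] inj by (simp add: distinct_map)
      ultimately show "map ((!) vs) ps \<in> ?Q"
        using ps(2) vs(4) by (simp add: circuit_traversal_iff)
    qed
    show "map ?h \<in> ?Q \<rightarrow> ?P"
    proof
      fix us assume "us \<in> ?Q"
      then have us: "distinct us" "length us = m" "traversed_edges us = traversed_edges vs"
        by (auto simp: circuit_traversal_iff)
      have "traversed_edges (map ?h us) = traversed_edges [0..<m]"
        using us(3) traversed_edges_map[of ?h vs] by (simp add: traversed_edges_map map_h)
      then show "map ?h us \<in> ?P"
        using us setQ[OF us(3)] \<open>inj_on ?h (set vs)\<close> by (auto simp: distinct_map)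
    qed
    show "map ?h (map ((!) vs) ps) = ps" if "ps \<in> ?P" for ps
    proof -
      have "set ps = {0..<m}" using that setP by blast
      then show ?thesis unfolding map_map by (intro map_idI) (auto simp: h_vs)
    qed
    show "map ((!) vs) (map ?h us) = us" if "us \<in> ?Q" for us
    proof -
      have "set us = set vs" using that setQ by blast
      then show ?thesis unfolding map_map by (intro map_idI) (auto simp: vs_h)
    qed
  qed
  from bij_betw_same_card[OF this] show ?thesis unfolding traversal_count_def by (rule sym)
qed

lemma cycle_weight_sum_eq_signed_circuit_count:
  assumes V: "finite (fst G)" and m: "m \<ge> 3" "even m"
    and D: "\<And>x y. {x, y} \<in> snd G \<Longrightarrow> D y x \<longleftrightarrow> \<not> D x y"
  defines "pos \<equiv> positively_oriented G D m"
  shows "sum (cycle_weight (arrow_sign (snd G) D)) (distinct_lists (fst G) m)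
    = int (traversal_count m)
      * (int (card {C \<in> circuits G m. pos C}) - int (card {C \<in> circuits G m. \<not> pos C}))"
proof -
  let ?w = "cycle_weight (arrow_sign (snd G) D)"
  let ?T = "{vs. circuit_traversal G m vs}"
  have sub: "?T \<subseteq> distinct_lists (fst G) m"
    by (auto simp: circuit_traversal_def distinct_lists_def)
  have finT: "finite ?T" using finite_subset[OF sub finite_distinct_lists_length[OF V]] .
  have circ: "circuits G m = traversed_edges ` ?T" by (auto simp: circuits_def)
  have finC: "finite (circuits G m)" unfolding circ using finT by simp
  have "?w vs = 0" if vs: "vs \<in> distinct_lists (fst G) m - ?T" for vs
  proof -
    obtain i where "i < length vs" "{vs ! i, vs ! (Suc i mod length vs)} \<notin> snd G"
      using vs by (auto simp: circuit_traversal_def distinct_lists_def)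
    then show ?thesis unfolding cycle_weight_def by (intro prod_zero) (auto simp: arrow_sign_def)
  qed
  then have "sum ?w (distinct_lists (fst G) m) = sum ?w ?T"
    using sub finite_distinct_lists_length[OF V] by (intro sum.mono_neutral_right) auto
  also have "\<dots> = (\<Sum>C\<in>circuits G m. \<Sum>us | us \<in> ?T \<and> traversed_edges us = C. ?w us)"
    unfolding circ by (rule sum.image_gen[OF finT])
  also have "\<dots> = (\<Sum>C\<in>circuits G m. int (traversal_count m) * (if pos C then 1 else -1))"
  proof (rule sum.cong)
    fix C assume "C \<in> circuits G m"
    then obtain vs where vs: "circuit_traversal G m vs" "C = traversed_edges vs" by (auto simp: circuits_def)
    have "(\<Sum>us | us \<in> ?T \<and> traversed_edges us = C. ?w us)
        = (\<Sum>us | us \<in> ?T \<and> traversed_edges us = C. if pos C then 1 else -1)"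
    proof (rule sum.cong)
      fix us assume "us \<in> {us. us \<in> ?T \<and> traversed_edges us = C}"
      then have us: "circuit_traversal G m us" "C = traversed_edges us" by auto
      have "pos C \<longleftrightarrow> even (forward_arrows D us)"
        unfolding pos_def us(2) by (rule positively_oriented_iff[OF us(1) m D])
      then show "?w us = (if pos C then 1 else -1)"
        using cycle_weight_arrow_sign[OF us(1) m(2), of D] by simp
    qed simp
    also have "\<dots> = int (traversal_count m) * (if pos C then 1 else -1)"
      using card_traversals[OF vs(1)] vs(2) by simp
    finally show "(\<Sum>us | us \<in> ?T \<and> traversed_edges us = C. ?w us)
        = int (traversal_count m) * (if pos C then 1 else -1)" .
  qed simp
  also have "\<dots> = int (traversal_count m)
      * (int (card {C \<in> circuits G m. pos C}) - int (card {C \<in> circuits G m. \<not> pos C}))"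
  proof -
    have "circuits G m \<inter> {C. pos C} = {C \<in> circuits G m. pos C}"
      "circuits G m \<inter> - {C. pos C} = {C \<in> circuits G m. \<not> pos C}" by blast+
    then show ?thesis using finC by (simp add: sum_distrib_left[symmetric] sum.If_cases)
  qed
  finally show ?thesis .
qed

section \<open>Principal unimodularity of the signed crossing matrix\<close>

text \<open>Real numbers stand for the points of the circle after it has been cut open at one point; the
  cut circle is scaled to the half-open unit interval.\<close>

definition before :: "real \<Rightarrow> real \<Rightarrow> int" where
  "before p q = (if p < q then 1 else 0)"

text \<open>For \<open>p\<close> different from both ends, this is \<open>1\<close> or \<open>-1\<close> if \<open>p\<close> lies between \<open>a\<close> and \<open>a'\<close>, depending on which
  of them comes first, and \<open>0\<close> otherwise.\<close>

definition side :: "real \<Rightarrow> real \<Rightarrow> real \<Rightarrow> int" where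
  "side a a' p = before a p - before a' p"

text \<open>The signed crossing number of the chord from \<open>a\<close> to \<open>a'\<close> with the chord from \<open>b\<close> to \<open>b'\<close>. Being a
  sum of four values of \<open>before\<close>, it is additive in both chords, and this is
  what makes it behave well under elimination.\<close>

definition crossing :: "real \<Rightarrow> real \<Rightarrow> real \<Rightarrow> real \<Rightarrow> int" where
  "crossing a a' b b' = side a a' b - side a a' b'"

text \<open>The diagonal is set to \<open>0\<close> separately, because \<open>crossing a a' a a' = -1\<close> for
  \<open>a \<noteq> a'\<close> by the convention that \<open>before p p = 0\<close>.\<close>

definition crossing_matrix :: "('a \<Rightarrow> real) \<Rightarrow> ('a \<Rightarrow> real) \<Rightarrow> 'a \<Rightarrow> 'a \<Rightarrow> int" where
  "crossing_matrix u v i j = (if i = j then 0 else crossing (u i) (v i) (u j) (v j))"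

definition disjoint_ends :: "'a set \<Rightarrow> ('a \<Rightarrow> real) \<Rightarrow> ('a \<Rightarrow> real) \<Rightarrow> bool" where
  "disjoint_ends I u v \<longleftrightarrow> inj_on u I \<and> inj_on v I \<and> (\<forall>i\<in>I. \<forall>j\<in>I. u i \<noteq> v j)"

lemma disjoint_endsD:
  assumes "disjoint_ends I u v" "i \<in> I" "j \<in> I"
  shows "u i \<noteq> v j" "v i \<noteq> u j" "i \<noteq> j \<Longrightarrow> u i \<noteq> u j" "i \<noteq> j \<Longrightarrow> v i \<noteq> v j"
  using assms unfolding disjoint_ends_def inj_on_def by metis+

lemma disjoint_ends_comp:
  assumes "disjoint_ends J u v" "inj_on f I" "f ` I \<subseteq> J"
  shows "disjoint_ends I (u \<circ> f) (v \<circ> f)"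
proof -
  have "inj_on u (f ` I)" "inj_on v (f ` I)"
    using assms unfolding disjoint_ends_def by (meson inj_on_subset)+
  then have "inj_on (u \<circ> f) I" "inj_on (v \<circ> f) I"
    using assms(2) by (simp_all add: comp_inj_on)
  then show ?thesis using assms(1,3) by (simp add: disjoint_ends_def image_subset_iff)
qed

lemma crossing_skew:
  assumes "{a, a'} \<inter> {b, b'} = {}"
  shows "crossing b b' a a' = - crossing a a' b b'"
  using assms by (auto simp: crossing_def side_def before_def)

lemma crossing_cases:
  assumes "a \<noteq> a'" "{a, a'} \<inter> {b, b'} = {}"
  shows "crossing a a' b b' \<in> {-1, 0, 1}"
  using assms by (auto simp: crossing_def side_def before_def)

text \<open>\<open>\<phi>\<close> moves the points in such a way that the change of their mutual order is precisely the correction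
  term of the elimination of the chords \<open>{a, a'}\<close> and \<open>{b, b'}\<close>. The formula is insensitive to
  reversing and to exchanging these two chords; so it suffices to construct \<open>\<phi>\<close> for one position
  of the ends.\<close>

definition pivot_rearrangement :: "real \<Rightarrow> real \<Rightarrow> real \<Rightarrow> real \<Rightarrow> (real \<Rightarrow> real) \<Rightarrow> bool" where
  "pivot_rearrangement a a' b b' \<phi> \<longleftrightarrow>
     (\<forall>p\<in>{0..<1}. \<phi> p \<in> {0..<1}) \<and>
     (\<forall>p\<in>{0..<1} - {a, a', b, b'}. \<forall>q\<in>{0..<1} - {a, a', b, b'}. p \<noteq> q \<longrightarrow>
       before (\<phi> p) (\<phi> q) = before p q
         - crossing a a' b b' * (side a a' p * side b b' q - side b b' p * side a a' q))"

lemma pivot_rearrangement_flip: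
  assumes "pivot_rearrangement a a' b b' \<phi>"
  shows "pivot_rearrangement a' a b b' \<phi>"
proof -
  have "side a' a p = - side a a' p" for p by (simp add: side_def)
  then have eq: "crossing a' a b b' * (side a' a p * x - y * side a' a q)
     = crossing a a' b b' * (side a a' p * x - y * side a a' q)" for p q x y
    by (simp add: crossing_def algebra_simps)
  show ?thesis using assms unfolding pivot_rearrangement_def eq by auto
qed

lemma pivot_rearrangement_swap:
  assumes "pivot_rearrangement a a' b b' \<phi>" "{a, a'} \<inter> {b, b'} = {}"
  shows "pivot_rearrangement b b' a a' \<phi>"
proof -
  have eq: "crossing b b' a a' * (x - y) = crossing a a' b b' * (y - x)" for x y
    using crossing_skew[OF assms(2)] by (simp add: algebra_simps)
  show ?thesis using assms(1) unfolding pivot_rearrangement_def eq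
    by (auto simp: mult.commute)
qed

text \<open>Let \<open>P\<close>, \<open>Q\<close>, \<open>S\<close> be the three arcs between consecutive points of \<open>a\<close>, \<open>b\<close>, \<open>a'\<close>, \<open>b'\<close>. The two values of \<open>side\<close>
  are \<open>(1, 0)\<close> on \<open>P\<close>, \<open>(1, 1)\<close> on \<open>Q\<close>, \<open>(0, 1)\<close> on \<open>S\<close>, and \<open>(0, 0)\<close> elsewhere. Hence the correction is
  \<open>1\<close> for a point of one of these arcs followed by a point of a later one, and \<open>0\<close> if both points are on the same arc or one is on
  none of them. So the order of these arcs has to be reversed.\<close>

lemma pivot_rearrangement_sorted:
  assumes "a < b" "b < a'" "a' < b'"
  shows "\<exists>\<phi>. pivot_rearrangement a a' b b' \<phi>"
proof -
  \<comment> \<open>\<open>\<kappa>\<close> is the new rank of the arc that contains \<open>p\<close>. The points stay in their old order inside each arc,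
    as the map \<open>\<phi>\<close> below only shifts and scales the arc.\<close>
  define \<kappa> :: "real \<Rightarrow> real" where
    "\<kappa> p = (if p < a then 0 else if p < b then 3 else if p < a' then 2 else if p < b' then 1 else 4)" for p
  define \<phi> where "\<phi> p = (p + \<kappa> p) / 5" for p
  have cross: "crossing a a' b b' = 1" using assms by (simp add: crossing_def side_def before_def)
  have \<kappa>: "0 \<le> \<kappa> p" "\<kappa> p \<le> 4" for p by (simp_all add: \<kappa>_def)
  have range: "\<phi> p \<in> {0..<1}" if "p \<in> {0..<1}" for p
    using that \<kappa>[of p] by (simp add: \<phi>_def)
  have order: "before (\<phi> p) (\<phi> q)
      = before p q - (side a a' p * side b b' q - side b b' p * side a a' q)"
    if p: "p \<in> {0..<1} - {a, a', b, b'}" and q: "q \<in> {0..<1} - {a, a', b, b'}" and "p \<noteq> q" for p q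
  proof -
    have arcs: "p < a \<and> \<kappa> p = 0 \<and> side a a' p = 0 \<and> side b b' p = 0
        \<or> a < p \<and> p < b \<and> \<kappa> p = 3 \<and> side a a' p = 1 \<and> side b b' p = 0
        \<or> b < p \<and> p < a' \<and> \<kappa> p = 2 \<and> side a a' p = 1 \<and> side b b' p = 1
        \<or> a' < p \<and> p < b' \<and> \<kappa> p = 1 \<and> side a a' p = 0 \<and> side b b' p = 1
        \<or> b' < p \<and> \<kappa> p = 4 \<and> side a a' p = 0 \<and> side b b' p = 0"
      if off: "p \<in> {0..<1} - {a, a', b, b'}" for p
    proof -
      consider "p < a" | "a < p" "p < b" | "b < p" "p < a'" | "a' < p" "p < b'" | "b' < p"
        using off by fastforce
      then show ?thesis
        using assms by cases (simp_all add: \<kappa>_def side_def before_def)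
    qed
    have *: "before (\<phi> p) (\<phi> q) = (if p + \<kappa> p < q + \<kappa> q then 1 else 0)"
      by (simp add: before_def \<phi>_def divide_less_cancel)
    have "0 \<le> p" "p < 1" "0 \<le> q" "q < 1" using p q by auto
    with arcs[OF p] arcs[OF q] show ?thesis
      unfolding * unfolding before_def using assms by (elim disjE conjE) simp_all
  qed
  show ?thesis
    unfolding pivot_rearrangement_def cross mult_1
    by (intro exI[of _ \<phi>] conjI ballI impI range order)
qed

lemma pivot_rearrangement_exists:
  assumes "a \<noteq> a'" "b \<noteq> b'" "{a, a'} \<inter> {b, b'} = {}" "crossing a a' b b' \<noteq> 0"
  shows "\<exists>\<phi>. pivot_rearrangement a a' b b' \<phi>"
proof -
  have *: "\<exists>\<phi>. pivot_rearrangement a a' b b' \<phi>"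
    if "a < a'" "b < b'" "{a, a'} \<inter> {b, b'} = {}" "crossing a a' b b' \<noteq> 0" for a a' b b'
  proof (cases "a < b")
    case True
    then have "b < a'" "a' < b'" using that by (auto simp: crossing_def side_def before_def split: if_splits)
    then show ?thesis using True pivot_rearrangement_sorted by blast
  next
    case False
    then have "b < a" "a < b'" "b' < a'" using that by (auto simp: crossing_def side_def before_def split: if_splits)
    then obtain \<phi> where "pivot_rearrangement b b' a a' \<phi>" using pivot_rearrangement_sorted by blast
    then show ?thesis using pivot_rearrangement_swap[of b b' a a' \<phi>] that(3) by (auto simp: Int_commute)
  qed
  have flip: "crossing a' a b b' = - crossing a a' b b'" "crossing a a' b' b = - crossing a a' b b'" for a a' b b'
    by (simp_all add: crossing_def side_def)
  have flip_right: "pivot_rearrangement a a' b' b \<phi>"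
    if "pivot_rearrangement a a' b b' \<phi>" "{a, a'} \<inter> {b, b'} = {}" for a a' b b' \<phi>
  proof -
    have "pivot_rearrangement b' b a a' \<phi>"
      using pivot_rearrangement_swap[OF that] by (rule pivot_rearrangement_flip)
    then show ?thesis by (rule pivot_rearrangement_swap) (use that in auto)
  qed
  have **: "\<exists>\<phi>. pivot_rearrangement a a' b b' \<phi>"
    if prems: "a < a'" "b \<noteq> b'" "{a, a'} \<inter> {b, b'} = {}" "crossing a a' b b' \<noteq> 0" for a a' b b'
  proof (cases "b < b'")
    case False
    then obtain \<phi> where "pivot_rearrangement a a' b' b \<phi>" using *[of a a' b' b] prems by (auto simp: flip(2)[of a a' b' b])
    then show ?thesis using flip_right[of a a' b' b \<phi>] prems(3) by (auto simp: Int_commute)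
  next
    case True
    show ?thesis by (rule *[OF prems(1) True prems(3,4)])
  qed
  show ?thesis
  proof (cases "a < a'")
    case False
    then obtain \<phi> where "pivot_rearrangement a' a b b' \<phi>"
      using **[of a' a b b'] assms by (auto simp: flip(1)[of a' a b b'])
    then show ?thesis using pivot_rearrangement_flip by blast
  next
    case True
    show ?thesis by (rule **[OF True assms(2-)])
  qed
qed

lemma crossing_matrix_skew:
  assumes "disjoint_ends I u v" "i \<in> I" "j \<in> I"
  shows "crossing_matrix u v j i = - crossing_matrix u v i j"
proof (cases "i = j")
  case False
  then have "{u i, v i} \<inter> {u j, v j} = {}"
    using disjoint_endsD[OF assms] disjoint_endsD(1)[OF assms(1,2,2)] by auto
  then show ?thesis using False crossing_skew[of "u i" "v i" "u j" "v j"] by (simp add: crossing_matrix_def)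
qed (simp add: crossing_matrix_def)

lemma crossing_matrix_cases:
  assumes "disjoint_ends I u v" "i \<in> I" "j \<in> I"
  shows "crossing_matrix u v i j \<in> {-1, 0, 1}"
proof (cases "i = j")
  case False
  then have "u i \<noteq> v i" "{u i, v i} \<inter> {u j, v j} = {}"
    using disjoint_endsD[OF assms] disjoint_endsD(1)[OF assms(1,2,2)] by auto
  then show ?thesis using False crossing_cases[of "u i"] by (simp add: crossing_matrix_def)
qed (simp add: crossing_matrix_def)

text \<open>Two crossing chords are eliminated, and the rearrangement above exhibits the remaining matrix as the
  signed crossing matrix of a smaller family of chords. If no two chords cross, the matrix is zero.\<close>

theorem crossing_matrix_principally_unimodular:
  assumes "finite I" "disjoint_ends I u v" "u ` I \<subseteq> {0..<1}" "v ` I \<subseteq> {0..<1}"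
  shows "principal_minor (crossing_matrix u v) I \<in> {0, 1}"
  using assms
proof (induction "card I" arbitrary: I u v rule: less_induct)
  case less
  let ?M = "crossing_matrix u v"
  consider "I = {}" | "I \<noteq> {}" "\<forall>a\<in>I. \<forall>b\<in>I. ?M a b = 0"
    | a b where "a \<in> I" "b \<in> I" "?M a b \<noteq> 0" by blast
  then show ?case
  proof cases
    case 2
    then obtain i where "i \<in> I" "\<And>j. j \<in> I \<Longrightarrow> ?M i j = 0" by blast
    then have "principal_minor ?M I = 0" using less.prems(1) by (intro principal_minor_zero_row) auto
    then show ?thesis by simp
  next
    case (3 a b)
    define S where "S = I - {a, b}"
    have ab: "a \<noteq> b" using 3 by (auto simp: crossing_matrix_def)
    have I: "I = insert a (insert b S)" "a \<notin> S" "b \<notin> S" and fin: "finite S"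
      using 3 less.prems(1) by (auto simp: S_def)
    let ?m = "?M a b"
    have m: "?m = crossing (u a) (v a) (u b) (v b)" using ab by (simp add: crossing_matrix_def)
    note ends = disjoint_endsD[OF less.prems(2)]
    have "\<exists>\<phi>. pivot_rearrangement (u a) (v a) (u b) (v b) \<phi>"
    proof (rule pivot_rearrangement_exists)
      show "{u a, v a} \<inter> {u b, v b} = {}"
        using ends[OF 3(1,2)] ab by auto
    qed (use ends(1)[OF 3(1,1)] ends(1)[OF 3(2,2)] 3(3) m in auto)
    then obtain \<phi> where \<phi>: "pivot_rearrangement (u a) (v a) (u b) (v b) \<phi>" ..
    let ?E = "u ` S \<union> v ` S"
    have E: "p \<in> {0..<1} - {u a, v a, u b, v b}" if p: "p \<in> ?E" for p
    proof -
      obtain i where i: "i \<in> S" "p = u i \<or> p = v i" using p by blast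
      then have "i \<in> I" "i \<noteq> a" "i \<noteq> b" using I by auto
      then show ?thesis
        using i(2) ends[of i a] ends[of i b] 3(1,2) less.prems(3,4) by (auto simp: subset_eq image_iff)
    qed
    have \<phi>_before: "before (\<phi> p) (\<phi> q) = before p q
        - ?m * (side (u a) (v a) p * side (u b) (v b) q - side (u b) (v b) p * side (u a) (v a) q)"
      if "p \<in> ?E" "q \<in> ?E" "p \<noteq> q" for p q
      using \<phi> E[OF that(1)] E[OF that(2)] that(3) unfolding pivot_rearrangement_def m by blast
    \<comment> \<open>The correction term is antisymmetric in \<open>p\<close> and \<open>q\<close>, and so exactly one of \<open>\<phi> p < \<phi> q\<close> and \<open>\<phi> q < \<phi> p\<close> holds.\<close>
    have \<phi>_inj: "\<phi> p \<noteq> \<phi> q" if "p \<in> ?E" "q \<in> ?E" "p \<noteq> q" for p q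
    proof -
      have "before (\<phi> p) (\<phi> q) + before (\<phi> q) (\<phi> p) = before p q + before q p"
        using \<phi>_before[of p q] \<phi>_before[of q p] that by (simp add: algebra_simps)
      then show ?thesis using that by (auto simp: before_def split: if_splits)
    qed
    have "principal_minor ?M I
        = principal_minor (\<lambda>i j. ?M i j - ?m * (?M i b * ?M a j - ?M i a * ?M b j)) S"
      unfolding I(1)
    proof (rule principal_minor_pivot)
      show "?M j i = - ?M i j" if "i \<in> insert a (insert b S)" "j \<in> insert a (insert b S)" for i j
        using crossing_matrix_skew[OF less.prems(2)] that unfolding I(1)[symmetric] by blast
      show "?m * ?m = 1" using crossing_matrix_cases[OF less.prems(2) 3(1,2)] 3(3) by auto
    qed (use fin I(2,3) ab in auto)
    also have "\<dots> = principal_minor (crossing_matrix (\<phi> \<circ> u) (\<phi> \<circ> v)) S"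
    proof (rule principal_minor_cong)
      fix i j assume ij: "i \<in> S" "j \<in> S"
      have IJ: "i \<in> I" "j \<in> I" "i \<noteq> a" "i \<noteq> b" "j \<noteq> a" "j \<noteq> b" using ij I by auto
      have sk: "?M i a = - ?M a i" "?M i b = - ?M b i"
        using crossing_matrix_skew[OF less.prems(2)] IJ(1) 3(1,2) by blast+
      show "?M i j - ?m * (?M i b * ?M a j - ?M i a * ?M b j) = crossing_matrix (\<phi> \<circ> u) (\<phi> \<circ> v) i j"
      proof (cases "i = j")
        case True
        then show ?thesis using sk by (simp add: crossing_matrix_def)
      next
        case False
        have row: "?M a j = side (u a) (v a) (u j) - side (u a) (v a) (v j)"
                  "?M b j = side (u b) (v b) (u j) - side (u b) (v b) (v j)"
                  "?M a i = side (u a) (v a) (u i) - side (u a) (v a) (v i)"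
                  "?M b i = side (u b) (v b) (u i) - side (u b) (v b) (v i)"
          using IJ by (auto simp: crossing_matrix_def crossing_def)
        have cross: "crossing x x' y y' = before x y - before x' y - before x y' + before x' y'" for x x' y y'
          by (simp add: crossing_def side_def)
        have "crossing_matrix (\<phi> \<circ> u) (\<phi> \<circ> v) i j = crossing (\<phi> (u i)) (\<phi> (v i)) (\<phi> (u j)) (\<phi> (v j))"
          and "?M i j = crossing (u i) (v i) (u j) (v j)"
          using False by (simp_all add: crossing_matrix_def)
        moreover have "before (\<phi> x) (\<phi> y) = before x y
            - ?m * (side (u a) (v a) x * side (u b) (v b) y - side (u b) (v b) x * side (u a) (v a) y)"
          if "x \<in> {u i, v i}" "y \<in> {u j, v j}" for x y
        proof (rule \<phi>_before)
          show "x \<noteq> y" using that False ends[OF IJ(1,2)] by auto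
        qed (use that ij in auto)
        ultimately show ?thesis
          unfolding sk row cross by (simp add: algebra_simps del: minus_mult_minus)
      qed
    qed
    also have "\<dots> \<in> {0, 1}"
    proof (rule less.hyps)
      show "card S < card I" using less.prems(1) 3 by (auto simp: S_def intro!: psubset_card_mono)
      have mem: "i \<in> I" "u i \<in> ?E" "v i \<in> ?E" if "i \<in> S" for i using that I(1) by auto
      have \<phi>_range: "\<phi> p \<in> {0..<1}" if "p \<in> ?E" for p
        using \<phi> E[OF that] unfolding pivot_rearrangement_def by (meson DiffD1)
      show "disjoint_ends S (\<phi> \<circ> u) (\<phi> \<circ> v)"
        unfolding disjoint_ends_def
      proof (intro conjI inj_onI ballI)
        fix i j assume ij: "i \<in> S" "j \<in> S"
        note I' = mem(1)[OF ij(1)] mem(1)[OF ij(2)]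
        show "i = j" if "(\<phi> \<circ> u) i = (\<phi> \<circ> u) j"
          using that \<phi>_inj[OF mem(2)[OF ij(1)] mem(2)[OF ij(2)]] ends(3)[OF I'] by fastforce
        show "i = j" if "(\<phi> \<circ> v) i = (\<phi> \<circ> v) j"
          using that \<phi>_inj[OF mem(3)[OF ij(1)] mem(3)[OF ij(2)]] ends(4)[OF I'] by fastforce
        show "(\<phi> \<circ> u) i \<noteq> (\<phi> \<circ> v) j"
          using \<phi>_inj[OF mem(2)[OF ij(1)] mem(3)[OF ij(2)]] ends(1)[OF I'] by simp
      qed
      show "(\<phi> \<circ> u) ` S \<subseteq> {0..<1}" "(\<phi> \<circ> v) ` S \<subseteq> {0..<1}"
        using \<phi>_range mem by (simp_all add: image_subset_iff)
    qed (rule fin)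
    finally show ?thesis .
  qed simp
qed

section \<open>Chord diagrams on the unit circle\<close>

definition angle :: "complex \<Rightarrow> real" where
  "angle z = Arg2pi z / (2 * pi)"

lemma angle_range: "angle z \<in> {0..<1}"
  using Arg2pi_ge_0[of z] Arg2pi_lt_2pi[of z] by (simp add: angle_def)

lemma angle_less_iff: "angle x < angle y \<longleftrightarrow> Arg2pi x < Arg2pi y"
  by (simp add: angle_def divide_less_cancel)

lemma angle_eq_iff:
  assumes "norm x = 1" "norm y = 1"
  shows "angle x = angle y \<longleftrightarrow> x = y"
proof
  assume "angle x = angle y"
  then have "Arg2pi x = Arg2pi y" by (simp add: angle_def)
  then show "x = y"
    using assms unfolding complex_norm_eq_1_exp by metis
qed simp

lemma Arg2pi_cis: "0 \<le> t \<Longrightarrow> t < 2 * pi \<Longrightarrow> Arg2pi (cis t) = t"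
  by (rule Arg2pi_unique[of 1]) (auto simp: cis_conv_exp)

lemma Arg2pi_divide_unit:
  assumes "norm x = 1" "norm a = 1"
  shows "Arg2pi (x / a) = (if Arg2pi a \<le> Arg2pi x then Arg2pi x - Arg2pi a
                           else Arg2pi x - Arg2pi a + 2 * pi)"
proof -
  have "cis (Arg2pi x) = x" "cis (Arg2pi a) = a"
    using assms complex_norm_eq_1_exp[of x] complex_norm_eq_1_exp[of a] by (simp_all add: cis_conv_exp)
  then have "cis (Arg2pi x - Arg2pi a) = x / a" by (simp flip: cis_divide)
  moreover have "cis (t + 2 * pi) = cis t" for t by (simp add: complex_eq_iff)
  ultimately have "cis (Arg2pi x - Arg2pi a) = x / a" "cis (Arg2pi x - Arg2pi a + 2 * pi) = x / a"
    by (simp_all only:)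
  then show ?thesis
    using Arg2pi_cis[of "Arg2pi x - Arg2pi a"] Arg2pi_cis[of "Arg2pi x - Arg2pi a + 2 * pi"]
      Arg2pi_ge_0[of x] Arg2pi_lt_2pi[of x] Arg2pi_ge_0[of a] Arg2pi_lt_2pi[of a] by (simp split: if_split)
qed

lemma mem_arc_iff:
  assumes "norm x = 1" "norm a = 1"
  shows "x \<in> arc_from_to a b \<longleftrightarrow> Arg2pi (x / a) \<le> Arg2pi (b / a)"
proof
  have a: "a \<noteq> 0" using assms by auto
  assume "x \<in> arc_from_to a b"
  then obtain t where t: "x = a * cis t" "0 \<le> t" "t \<le> Arg2pi (b / a)" by (auto simp: arc_from_to_def)
  then have "t < 2 * pi" using Arg2pi_lt_2pi[of "b / a"] by simp
  then show "Arg2pi (x / a) \<le> Arg2pi (b / a)" using t a by (simp add: Arg2pi_cis)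
next
  assume le: "Arg2pi (x / a) \<le> Arg2pi (b / a)"
  have "norm (x / a) = 1" using assms by (simp add: norm_divide)
  then have "x / a = cis (Arg2pi (x / a))" using complex_norm_eq_1_exp[of "x / a"] by (simp add: cis_conv_exp)
  then have "x = a * cis (Arg2pi (x / a))" using assms by (metis nonzero_mult_div_cancel_left norm_zero times_divide_eq_right zero_neq_one)
  then show "x \<in> arc_from_to a b" using le Arg2pi_ge_0[of "x / a"] unfolding arc_from_to_def by blast
qed

definition cyclically_ordered :: "real \<Rightarrow> real \<Rightarrow> real \<Rightarrow> bool" where
  "cyclically_ordered p q r \<longleftrightarrow> p < q \<and> q < r \<or> q < r \<and> r < p \<or> r < p \<and> p < q"

text \<open>Measuring angles from \<open>a\<close>, modulo the full angle \<open>c\<close>.\<close>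

lemma rotated_le_iff_cyclically_ordered:
  fixes a b c x :: real
  assumes "0 \<le> a" "a < c" "0 \<le> x" "x < c" "0 \<le> b" "b < c" "x \<noteq> a" "x \<noteq> b" "a \<noteq> b"
  shows "(if a \<le> x then x - a else x - a + c) \<le> (if a \<le> b then b - a else b - a + c)
    \<longleftrightarrow> cyclically_ordered a x b"
  using assms unfolding cyclically_ordered_def by (smt (verit))

lemma mem_arc_iff_cyclically_ordered:
  assumes "norm x = 1" "norm a = 1" "norm b = 1" "x \<noteq> a" "x \<noteq> b" "a \<noteq> b"
  shows "x \<in> arc_from_to a b \<longleftrightarrow> cyclically_ordered (angle a) (angle x) (angle b)"
proof -
  have ne: "Arg2pi x \<noteq> Arg2pi a" "Arg2pi x \<noteq> Arg2pi b" "Arg2pi a \<noteq> Arg2pi b"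
    using assms angle_eq_iff[of x a] angle_eq_iff[of x b] angle_eq_iff[of a b] by (simp_all add: angle_def)
  have "cyclically_ordered (angle a) (angle x) (angle b)
      \<longleftrightarrow> cyclically_ordered (Arg2pi a) (Arg2pi x) (Arg2pi b)"
    by (simp only: cyclically_ordered_def angle_less_iff)
  then show ?thesis
    unfolding mem_arc_iff[OF assms(1,2)] Arg2pi_divide_unit[OF assms(1,2)] Arg2pi_divide_unit[OF assms(3,2)]
    using rotated_le_iff_cyclically_ordered[OF Arg2pi_ge_0 Arg2pi_lt_2pi Arg2pi_ge_0 Arg2pi_lt_2pi
        Arg2pi_ge_0 Arg2pi_lt_2pi ne] by simp
qed

lemma crossing_eq_cyclic_order:
  assumes "a \<noteq> a'" "b \<noteq> b'" "{a, a'} \<inter> {b, b'} = {}"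
  shows "crossing a a' b b' =
    (if cyclically_ordered a b a' \<and> cyclically_ordered a' b' a then 1
     else if cyclically_ordered a b' a' \<and> cyclically_ordered a' b a then -1 else 0)"
proof -
  have "a \<noteq> b" "a \<noteq> b'" "a' \<noteq> b" "a' \<noteq> b'" using assms(3) by auto
  with assms(1,2) show ?thesis
    unfolding crossing_def side_def before_def cyclically_ordered_def by (smt (verit))
qed

lemma chords_intersect_iff_arcs:
  assumes "{a, a'} \<inter> {b, b'} = {}"
  shows "chords_intersect {a, a'} {b, b'} \<longleftrightarrow>
     b \<in> arc_from_to a a' \<and> b' \<in> arc_from_to a' a \<or> b' \<in> arc_from_to a a' \<and> b \<in> arc_from_to a' a"
  using assms unfolding chords_intersect_def by (auto simp: doubleton_eq_iff)

lemma chord_ends: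
  assumes "chord_diagram d" "chord_orientation d beg" "A \<in> d"
  shows "A = {beg A, chord_end beg A}" "beg A \<noteq> chord_end beg A" "norm (beg A) = 1" "norm (chord_end beg A) = 1"
proof -
  have A: "A \<subseteq> sphere 0 1" "card A = 2" "beg A \<in> A"
    using assms by (auto simp: chord_diagram_def chord_orientation_def)
  from A(2) obtain x y where xy: "A = {x, y}" "x \<noteq> y" by (auto simp: card_2_iff)
  define e where "e = (if beg A = x then y else x)"
  have e: "A = {beg A, e}" "beg A \<noteq> e" using xy A(3) unfolding e_def by force+
  then have "A - {beg A} = {e}" by blast
  then have "chord_end beg A = e" by (simp add: chord_end_def)
  then show "A = {beg A, chord_end beg A}" "beg A \<noteq> chord_end beg A" using e by simp_all
  then show "norm (beg A) = 1" "norm (chord_end beg A) = 1" using A(1) by (metis insert_subset mem_sphere_0)+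
qed

lemma chords_disjoint:
  assumes "chord_diagram d" "A \<in> d" "B \<in> d" "A \<noteq> B"
  shows "A \<inter> B = {}"
  using assms by (auto simp: chord_diagram_def pairwise_def disjnt_def)

lemma disjoint_ends_chords:
  assumes "chord_diagram d" "chord_orientation d beg"
  shows "disjoint_ends d (\<lambda>A. angle (beg A)) (\<lambda>A. angle (chord_end beg A))"
proof -
  note ends = chord_ends[OF assms]
  have ne: "x \<noteq> y" if "A \<in> d" "B \<in> d" "A \<noteq> B" "x \<in> A" "y \<in> B" for x y A B
    using chords_disjoint[OF assms(1)] that by blast
  have mem: "beg A \<in> A" "chord_end beg A \<in> A" if "A \<in> d" for A using ends(1)[OF that] by blast+
  show ?thesis
    unfolding disjoint_ends_def
  proof (intro conjI inj_onI ballI)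
    fix A B assume AB: "A \<in> d" "B \<in> d"
    note unit = ends(3,4)[OF AB(1)] ends(3,4)[OF AB(2)]
    show "A = B" if "angle (beg A) = angle (beg B)"
      using that ne[OF AB _ mem(1)[OF AB(1)] mem(1)[OF AB(2)]] unit by (auto simp: angle_eq_iff)
    show "A = B" if "angle (chord_end beg A) = angle (chord_end beg B)"
      using that ne[OF AB _ mem(2)[OF AB(1)] mem(2)[OF AB(2)]] unit by (auto simp: angle_eq_iff)
    show "angle (beg A) \<noteq> angle (chord_end beg B)"
      using ne[OF AB _ mem(1)[OF AB(1)] mem(2)[OF AB(2)]] ends(2)[OF AB(1)] unit
      by (cases "A = B") (auto simp: angle_eq_iff)
  qed
qed

definition chord_crossing :: "(chord \<Rightarrow> complex) \<Rightarrow> chord \<Rightarrow> chord \<Rightarrow> int" where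
  "chord_crossing beg = crossing_matrix (\<lambda>A. angle (beg A)) (\<lambda>A. angle (chord_end beg A))"

text \<open>Cutting the circle open at the point \<open>1\<close> turns the linear definition of the signed crossing number into the
  cyclic definition of crossings and arrows.\<close>

lemma chord_crossing_arcs:
  assumes "chord_diagram d" "chord_orientation d beg" "A \<in> d" "B \<in> d" "A \<noteq> B"
  shows "chord_crossing beg A B =
    (if chords_intersect A B then if beg B \<in> arc_from_to (beg A) (chord_end beg A) then 1 else -1 else 0)"
proof -
  let ?a = "beg A" and ?a' = "chord_end beg A" and ?b = "beg B" and ?b' = "chord_end beg B"
  note A = chord_ends[OF assms(1,2,3)] and B = chord_ends[OF assms(1,2,4)]
  have disj: "{?a, ?a'} \<inter> {?b, ?b'} = {}"
    using chords_disjoint[OF assms(1,3,4,5)] A(1) B(1) by simp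
  then have ne: "?b \<noteq> ?a" "?b \<noteq> ?a'" "?b' \<noteq> ?a" "?b' \<noteq> ?a'" by auto
  let ?cyc = "\<lambda>x y z. cyclically_ordered (angle x) (angle y) (angle z)"
  have arcs: "?b \<in> arc_from_to ?a ?a' \<longleftrightarrow> ?cyc ?a ?b ?a'" "?b' \<in> arc_from_to ?a' ?a \<longleftrightarrow> ?cyc ?a' ?b' ?a"
    "?b' \<in> arc_from_to ?a ?a' \<longleftrightarrow> ?cyc ?a ?b' ?a'" "?b \<in> arc_from_to ?a' ?a \<longleftrightarrow> ?cyc ?a' ?b ?a"
    using A(2-4) B(2-4) ne by (intro mem_arc_iff_cyclically_ordered; simp)+
  have "chords_intersect A B \<longleftrightarrow> ?cyc ?a ?b ?a' \<and> ?cyc ?a' ?b' ?a \<or> ?cyc ?a ?b' ?a' \<and> ?cyc ?a' ?b ?a"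
    using chords_intersect_iff_arcs[OF disj] A(1) B(1) arcs by metis
  moreover have "chord_crossing beg A B = (if ?cyc ?a ?b ?a' \<and> ?cyc ?a' ?b' ?a then 1
     else if ?cyc ?a ?b' ?a' \<and> ?cyc ?a' ?b ?a then -1 else 0)"
    unfolding chord_crossing_def crossing_matrix_def using A(2-4) B(2-4) ne assms(5)
    by (subst crossing_eq_cyclic_order) (auto simp: angle_eq_iff)
  moreover have "\<not> (?cyc ?a ?b ?a' \<and> ?cyc ?a' ?b ?a)"
    by (auto simp: cyclically_ordered_def)
  ultimately show ?thesis unfolding arcs by auto
qed

lemma chord_crossing_skew:
  assumes "chord_diagram d" "chord_orientation d beg" "A \<in> d" "B \<in> d"
  shows "chord_crossing beg B A = - chord_crossing beg A B"
  unfolding chord_crossing_def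
  by (rule crossing_matrix_skew[OF disjoint_ends_chords[OF assms(1,2)] assms(3,4)])

lemma fst_intersection_graph: "fst (intersection_graph d) = d"
  by (simp add: intersection_graph_def)

lemma adjacent_iff_chord_crossing:
  assumes "chord_diagram d" "chord_orientation d beg" "A \<in> d" "B \<in> d"
  shows "{A, B} \<in> snd (intersection_graph d) \<longleftrightarrow> chord_crossing beg A B \<noteq> 0"
proof (cases "A = B")
  case True
  then show ?thesis
    by (auto simp: intersection_graph_def chord_crossing_def crossing_matrix_def)
next
  case False
  have iff: "chords_intersect A B \<longleftrightarrow> chord_crossing beg A B \<noteq> 0"
    using chord_crossing_arcs[OF assms False] by simp
  have "chords_intersect B A \<longleftrightarrow> chord_crossing beg B A \<noteq> 0"
    using chord_crossing_arcs[OF assms(1,2,4,3) False[symmetric]] by simp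
  then have iff': "chords_intersect B A \<longleftrightarrow> chord_crossing beg A B \<noteq> 0"
    using chord_crossing_skew[OF assms] by simp
  have "{A, B} \<in> snd (intersection_graph d) \<longleftrightarrow> chords_intersect A B \<or> chords_intersect B A"
    unfolding intersection_graph_def snd_conv mem_Collect_eq doubleton_eq_iff
    using assms(3,4) False by blast
  then show ?thesis using iff iff' by simp
qed

lemma arrow_sign_eq_chord_crossing:
  assumes "chord_diagram d" "chord_orientation d beg" "A \<in> d" "B \<in> d"
  shows "arrow_sign (snd (intersection_graph d)) (arrow d beg) A B = chord_crossing beg A B"
proof (cases "A = B")
  case False
  then show ?thesis
    using chord_crossing_arcs[OF assms] adjacent_iff_chord_crossing[OF assms]
    by (auto simp: arrow_sign_def arrow_def split: if_splits)
qed (use adjacent_iff_chord_crossing[OF assms] in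
      \<open>auto simp: arrow_sign_def chord_crossing_def crossing_matrix_def\<close>)

lemma arrow_antisymmetric:
  assumes "chord_diagram d" "chord_orientation d beg" "{A, B} \<in> snd (intersection_graph d)"
  shows "arrow d beg B A \<longleftrightarrow> \<not> arrow d beg A B"
proof -
  have d: "A \<in> d" "B \<in> d" using assms(3) by (auto simp: intersection_graph_def doubleton_eq_iff)
  have E: "{B, A} \<in> snd (intersection_graph d)" using assms(3) by (simp add: insert_commute)
  show ?thesis
    using arrow_sign_eq_chord_crossing[OF assms(1,2) d] arrow_sign_eq_chord_crossing[OF assms(1,2) d(2,1)]
      chord_crossing_skew[OF assms(1,2) d] assms(3) E
    by (simp add: arrow_sign_def split: if_splits)
qed

section \<open>The number R as a function of the intersection graph\<close>

text \<open>Lists that are not traversals of circuits have weight \<open>0\<close>, and a traversal of a circuit contributes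
  the sign of this circuit.\<close>

lemma cycle_weight_sum_eq_R:
  assumes "k \<ge> 2" "chord_diagram d" "chord_orientation d beg"
  shows "sum (cycle_weight (chord_crossing beg)) (distinct_lists d (2 * k))
    = int (traversal_count (2 * k)) * R k d beg"
proof -
  let ?G = "intersection_graph d"
  have "sum (cycle_weight (chord_crossing beg)) (distinct_lists d (2 * k))
      = sum (cycle_weight (arrow_sign (snd ?G) (arrow d beg))) (distinct_lists (fst ?G) (2 * k))"
    unfolding fst_intersection_graph
  proof (rule sum.cong[OF refl])
    fix vs assume "vs \<in> distinct_lists d (2 * k)"
    then have "set vs \<subseteq> d" by (simp add: distinct_lists_def)
    then show "cycle_weight (chord_crossing beg) vs = cycle_weight (arrow_sign (snd ?G) (arrow d beg)) vs"
      by (rule cycle_weight_cong) (simp add: arrow_sign_eq_chord_crossing[OF assms(2,3)])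
  qed
  also have "\<dots> = int (traversal_count (2 * k)) * R k d beg"
    unfolding R_def Let_def
  proof (rule cycle_weight_sum_eq_signed_circuit_count)
    show "finite (fst ?G)" using assms(2) by (simp add: fst_intersection_graph chord_diagram_def)
  qed (use assms(1) arrow_antisymmetric[OF assms(2,3)] in auto)
  finally show ?thesis .
qed

text \<open>Both minors are \<open>0\<close> or \<open>1\<close>, and they agree modulo \<open>2\<close>, where signs are invisible.\<close>

theorem crossing_minors_determined_by_graph:
  assumes d1: "chord_diagram d1" "chord_orientation d1 beg1"
    and d2: "chord_diagram d2" "chord_orientation d2 beg2"
    and f: "bij_betw f d1 d2"
    and adj: "\<And>A B. A \<in> d1 \<Longrightarrow> B \<in> d1 \<Longrightarrow>
      {A, B} \<in> snd (intersection_graph d1) \<longleftrightarrow> {f A, f B} \<in> snd (intersection_graph d2)"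
    and T: "T \<subseteq> d1"
  shows "principal_minor (chord_crossing beg1) T
    = principal_minor (\<lambda>A B. chord_crossing beg2 (f A) (f B)) T"
proof -
  let ?M = "chord_crossing beg1" and ?N = "\<lambda>A B. chord_crossing beg2 (f A) (f B)"
  have T': "finite T" "inj_on f T" "f ` T \<subseteq> d2"
    using d1(1) T f by (auto simp: chord_diagram_def bij_betw_def intro: finite_subset inj_on_subset)
  have unimodular: "principal_minor (crossing_matrix (angle \<circ> b \<circ> g) (angle \<circ> chord_end b \<circ> g)) T \<in> {0, 1}"
    if "chord_diagram d" "chord_orientation d b" "inj_on g T" "g ` T \<subseteq> d" for d b g
  proof (rule crossing_matrix_principally_unimodular)
    have "disjoint_ends d (angle \<circ> b) (angle \<circ> chord_end b)"
      using disjoint_ends_chords[OF that(1,2)] by (simp add: comp_def)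
    from disjoint_ends_comp[OF this that(3,4)]
    show "disjoint_ends T (angle \<circ> b \<circ> g) (angle \<circ> chord_end b \<circ> g)" .
    show "(angle \<circ> b \<circ> g) ` T \<subseteq> {0..<1}" "(angle \<circ> chord_end b \<circ> g) ` T \<subseteq> {0..<1}"
      using angle_range by (auto simp: image_subset_iff)
  qed (rule T')
  have "principal_minor ?M T \<in> {0, 1}"
    using unimodular[OF d1, of id] T by (simp add: chord_crossing_def comp_def)
  moreover have "principal_minor ?N T \<in> {0, 1}"
  proof -
    have "principal_minor ?N T
        = principal_minor (crossing_matrix (angle \<circ> beg2 \<circ> f) (angle \<circ> chord_end beg2 \<circ> f)) T"
      using T'(2) by (intro principal_minor_cong) (simp add: chord_crossing_def crossing_matrix_def inj_on_eq_iff)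
    then show ?thesis using unimodular[OF d2 T'(2,3)] by simp
  qed
  moreover have "principal_minor ?M T mod 2 = principal_minor ?N T mod 2"
  proof (rule principal_minor_mod_cong)
    fix A B assume "A \<in> T" "B \<in> T"
    then have AB: "A \<in> d1" "B \<in> d1" "f A \<in> d2" "f B \<in> d2" using T T'(3) by auto
    have "?M A B \<in> {-1, 0, 1}" "?N A B \<in> {-1, 0, 1}"
      using crossing_matrix_cases[OF disjoint_ends_chords[OF d1] AB(1,2)]
        crossing_matrix_cases[OF disjoint_ends_chords[OF d2] AB(3,4)]
      by (simp_all add: chord_crossing_def)
    moreover have "?M A B \<noteq> 0 \<longleftrightarrow> ?N A B \<noteq> 0"
      using adj[OF AB(1,2)] adjacent_iff_chord_crossing[OF d1 AB(1,2)]
        adjacent_iff_chord_crossing[OF d2 AB(3,4)] by blast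
    ultimately show "?M A B mod 2 = ?N A B mod 2" by auto
  qed
  ultimately show ?thesis by auto
qed

theorem theorem3p1:
  fixes k :: nat and d1 d2 :: "chord set" and beg1 beg2 :: "chord \<Rightarrow> complex"
  assumes "k \<ge> 2"
    and "chord_diagram d1" and "chord_diagram d2"
    and "chord_orientation d1 beg1" and "chord_orientation d2 beg2"
    and "sgraph_isomorphic (intersection_graph d1) (intersection_graph d2)"
  shows "R k d1 beg1 = R k d2 beg2"
proof -
  obtain f where f: "bij_betw f d1 d2"
    and adj: "\<And>A B. A \<in> d1 \<Longrightarrow> B \<in> d1 \<Longrightarrow>
      {A, B} \<in> snd (intersection_graph d1) \<longleftrightarrow> {f A, f B} \<in> snd (intersection_graph d2)"
    using assms(6) unfolding sgraph_isomorphic_def fst_intersection_graph by blast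
  have inj: "inj_on f d1" and img: "f ` d1 = d2" using f by (auto simp: bij_betw_def)
  let ?c = "int (traversal_count (2 * k))"
  have "?c * R k d1 beg1 = sum (cycle_weight (chord_crossing beg1)) (distinct_lists d1 (2 * k))"
    using cycle_weight_sum_eq_R[OF assms(1,2,4)] by simp
  also have "\<dots> = sum (cycle_weight (\<lambda>A B. chord_crossing beg2 (f A) (f B))) (distinct_lists d1 (2 * k))"
  proof (rule cycle_weight_sum_determined_by_minors)
    show "finite d1" using assms(2) by (simp add: chord_diagram_def)
    show "principal_minor (chord_crossing beg1) T
        = principal_minor (\<lambda>A B. chord_crossing beg2 (f A) (f B)) T" if "T \<subseteq> d1" for T
      by (rule crossing_minors_determined_by_graph[OF assms(2,4,3,5) f adj that])
  qed (use assms(1) in simp)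
  also have "\<dots> = sum (cycle_weight (chord_crossing beg2)) (distinct_lists d2 (2 * k))"
    using sum_cycle_weight_image[OF inj] img by simp
  also have "\<dots> = ?c * R k d2 beg2"
    using cycle_weight_sum_eq_R[OF assms(1,3,5)] .
  finally show ?thesis using traversal_count_pos[of "2 * k"] by simp
qed

end
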